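(* Let $f:X\to X$ be a continuous map of a compact metric space $(X,d)$. If either $f$ has only countably many distinct stable classes, or $f$ is Lyapunov stable on its recurrent set $R(f)$, then $f$ has zero topological entropy.
   Context: The stable class of $p\in X$ is $W^s(p)=\{x\in X:\lim_{n\to\infty}d(f^n(x),f^n(p))=0\}$. The recurrent set is $R(f)=\{x\in X: x\in\omega_f(x)\}$, where $\omega_f(x)$ is the set of limits $\lim_{k\to\infty}f^{n_k}(x)$ over sequences $n_k\to\infty$. $f$ is Lyapunov stable on $A\subset X$ if for every $x\in A$ and every $\epsilon>0$ there is a neighborhood $U(x)$ of $x$ such that $d(f^n(x),f^n(y))<\epsilon$ for all $n\ge 0$ and all $y\in U(x)\cap A$. *)

theory Defs
  imports "HOL-Analysis.Analysis"
begin

definition stable_class :: "('a::metric_space \<Rightarrow> 'a) \<Rightarrow> 'a set \<Rightarrow> 'a \<Rightarrow> 'a set" where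
  "stable_class f X p = {x \<in> X. (\<lambda>n. dist ((f ^^ n) x) ((f ^^ n) p)) \<longlonglongrightarrow> 0}"

definition omega_limit :: "('a::metric_space \<Rightarrow> 'a) \<Rightarrow> 'a \<Rightarrow> 'a set" where
  "omega_limit f x = {y. \<exists>r. strict_mono r \<and> (\<lambda>k. (f ^^ (r k)) x) \<longlonglongrightarrow> y}"

definition recurrent_set :: "('a::metric_space \<Rightarrow> 'a) \<Rightarrow> 'a set \<Rightarrow> 'a set" where
  "recurrent_set f X = {x \<in> X. x \<in> omega_limit f x}"

definition lyapunov_stable_on :: "('a::metric_space \<Rightarrow> 'a) \<Rightarrow> 'a set \<Rightarrow> bool" where
  "lyapunov_stable_on f A \<longleftrightarrow>
     (\<forall>x\<in>A. \<forall>e>0. \<exists>U. open U \<and> x \<in> U \<and>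
        (\<forall>y\<in>U \<inter> A. \<forall>n. dist ((f ^^ n) x) ((f ^^ n) y) < e))"

text \<open>Bowen's definition of topological entropy via (n,e)-separated sets.\<close>

definition separated :: "('a::metric_space \<Rightarrow> 'a) \<Rightarrow> nat \<Rightarrow> real \<Rightarrow> 'a set \<Rightarrow> bool" where
  "separated f n e S \<longleftrightarrow>
     (\<forall>x\<in>S. \<forall>y\<in>S. x \<noteq> y \<longrightarrow> (\<exists>k<n. dist ((f ^^ k) x) ((f ^^ k) y) > e))"

definition max_sep :: "('a::metric_space \<Rightarrow> 'a) \<Rightarrow> 'a set \<Rightarrow> nat \<Rightarrow> real \<Rightarrow> nat" where
  "max_sep f X n e = Sup {card S | S. S \<subseteq> X \<and> finite S \<and> separated f n e S}"

definition topological_entropy :: "('a::metric_space \<Rightarrow> 'a) \<Rightarrow> 'a set \<Rightarrow> ereal" where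
  "topological_entropy f X =
     (SUP e\<in>{0<..}. limsup (\<lambda>n. ereal (ln (real (max_sep f X n e)) / real n)))"

end

(*
Positive entropy forces combinatorial independence: there are disjoint closed sets
A0 = {x. d(p,x) <= r} and A1 = {x. d(p,x) >= 2r} and a set J of times with positive density such
that every prescription of A0 or A1 at the times in J is realized by an orbit. To see this, take an
exponentially large separated set, thin it out until any two points are far apart at a positive
proportion of the times, and count the sets of coordinates that it shatters: there are exponentially
many, so one of them has linear size. Such a J is infinite, and prescribing itineraries which differ
at infinitely many times gives uncountably many stable classes.

For the second alternative, Zorn's lemma gives a minimal closed invariant set Z carrying independence
of a fixed density. Following a generic prescription, some x in Z has an omega-limit set with
independence of the same density, so omega(x) = Z by minimality, and x is recurrent. If f is Lyapunov
stable on the recurrent set, then a return of x close to itself makes some f^k, k > 0, uniformly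
close to the identity on Z. But then an independence set is disjoint from its translates by k, 2k,
3k, ..., which is impossible for a set of positive density.
*)

theory Submission
  imports Defs
begin

section \<open>Shattered sets of coordinates and a count of Sauer-Shelah type\<close>

section \<open>Counting shattered sets\<close>

text \<open>Two predicates replace one predicate and its negation, because the conditions used
  later, near and far, leave a gap. With \<open>Q\<close> the negation of \<open>P\<close> this is
  shattering in the sense of Vapnik and Chervonenkis.\<close>

definition shatters :: "('i \<Rightarrow> 'b \<Rightarrow> bool) \<Rightarrow> ('i \<Rightarrow> 'b \<Rightarrow> bool) \<Rightarrow> 'b set \<Rightarrow> 'i set \<Rightarrow> bool" where
  "shatters P Q S W \<longleftrightarrow> (\<forall>I\<subseteq>W. \<exists>x\<in>S. (\<forall>i\<in>I. P i x) \<and> (\<forall>i\<in>W - I. Q i x))"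

lemma shattersD:
  assumes "shatters P Q S W" "I \<subseteq> W"
  obtains x where "x \<in> S" "\<And>i. i \<in> I \<Longrightarrow> P i x" "\<And>i. i \<in> W - I \<Longrightarrow> Q i x"
  using assms unfolding shatters_def by meson

lemma shatters_mono_set: "shatters P Q S W \<Longrightarrow> S \<subseteq> T \<Longrightarrow> shatters P Q T W"
  unfolding shatters_def by (meson subsetD)

lemma shatters_subset:
  assumes "shatters P Q S W" "V \<subseteq> W"
  shows "shatters P Q S V"
  unfolding shatters_def
proof (intro allI impI)
  fix I assume I: "I \<subseteq> V"
  with assms(2) have "I \<subseteq> W" by blast
  from shattersD[OF assms(1) this] obtain x
    where x: "x \<in> S" "\<And>i. i \<in> I \<Longrightarrow> P i x" "\<And>i. i \<in> W - I \<Longrightarrow> Q i x" by blast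
  then show "\<exists>x\<in>S. (\<forall>i\<in>I. P i x) \<and> (\<forall>i\<in>V - I. Q i x)"
    using assms(2) by (intro bexI[of _ x]) auto
qed

text \<open>The demand at \<open>i\<close> selects the half that supplies the witness; since that
  half shatters \<open>W\<close>, the other demands can be met inside it.\<close>

lemma shatters_insert:
  assumes "shatters P Q {x \<in> S. P i x} W" "shatters P Q {x \<in> S. Q i x} W"
  shows "shatters P Q S (insert i W)"
  unfolding shatters_def
proof (intro allI impI)
  fix I assume I: "I \<subseteq> insert i W"
  have I': "I - {i} \<subseteq> W" using I by blast
  show "\<exists>x\<in>S. (\<forall>i\<in>I. P i x) \<and> (\<forall>j\<in>insert i W - I. Q j x)"
  proof (cases "i \<in> I")
    case True
    from shattersD[OF assms(1) I'] obtain x where "x \<in> {x \<in> S. P i x}"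
      "\<And>j. j \<in> I - {i} \<Longrightarrow> P j x" "\<And>j. j \<in> W - (I - {i}) \<Longrightarrow> Q j x" by blast
    then show ?thesis using True by (intro bexI[of _ x]) auto
  next
    case False
    from shattersD[OF assms(2) I'] obtain x where "x \<in> {x \<in> S. Q i x}"
      "\<And>j. j \<in> I - {i} \<Longrightarrow> P j x" "\<And>j. j \<in> W - (I - {i}) \<Longrightarrow> Q j x" by blast
    then show ?thesis using False by (intro bexI[of _ x]) auto
  qed
qed

text \<open>Double counting of the triples \<open>(i, x, y)\<close> with \<open>P i x\<close> and \<open>Q i y\<close>.\<close>

lemma exists_balanced_coordinate:
  fixes \<beta> :: real
  assumes fin: "finite C" "C \<noteq> {}" "finite S" and \<beta>: "0 < \<beta>" and two: "2 \<le> card S"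
    and sep: "\<And>x y. x \<in> S \<Longrightarrow> y \<in> S \<Longrightarrow> x \<noteq> y \<Longrightarrow> \<beta> * card C \<le> card {i \<in> C. P i x \<and> Q i y}"
  obtains i where "i \<in> C" "\<beta> / 2 * card S \<le> card {x \<in> S. P i x}"
    "\<beta> / 2 * card S \<le> card {x \<in> S. Q i x}"
proof (rule ccontr)
  assume "\<not> thesis"
  then have neg: "\<forall>i\<in>C. \<not> (\<beta> / 2 * card S \<le> card {x \<in> S. P i x} \<and> \<beta> / 2 * card S \<le> card {x \<in> S. Q i x})"
    using that by blast
  define N where "N = real (card S)"
  have N: "2 \<le> N" using two by (simp add: N_def)
  \<comment> \<open>At an unbalanced coordinate one factor is below \<open>\<beta> / 2 * N\<close>
    and the other is at most \<open>N\<close>.\<close>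
  have less: "real (card {x \<in> S. P i x}) * real (card {x \<in> S. Q i x}) < \<beta> / 2 * N\<^sup>2" if "i \<in> C" for i
  proof -
    have le: "real (card {x \<in> S. P i x}) \<le> N" "real (card {x \<in> S. Q i x}) \<le> N"
      using fin by (auto simp: N_def intro!: card_mono)
    from neg that have "card {x \<in> S. P i x} < \<beta> / 2 * N \<or> card {x \<in> S. Q i x} < \<beta> / 2 * N"
      unfolding N_def by force
    then show ?thesis
    proof
      assume a: "card {x \<in> S. P i x} < \<beta> / 2 * N"
      have "real (card {x \<in> S. P i x}) * real (card {x \<in> S. Q i x}) \<le> real (card {x \<in> S. P i x}) * N"
        using le by (intro mult_left_mono) auto
      also have "\<dots> < \<beta> / 2 * N * N" using a N by (intro mult_strict_right_mono) auto
      finally show ?thesis by (simp add: power2_eq_square ac_simps)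
    next
      assume a: "card {x \<in> S. Q i x} < \<beta> / 2 * N"
      have "real (card {x \<in> S. P i x}) * real (card {x \<in> S. Q i x}) \<le> N * real (card {x \<in> S. Q i x})"
        using le by (intro mult_right_mono) auto
      also have "\<dots> < N * (\<beta> / 2 * N)" using a N by (intro mult_strict_left_mono) auto
      finally show ?thesis by (simp add: power2_eq_square ac_simps)
    qed
  qed
  have "(\<Sum>i\<in>C. real (card {x \<in> S. P i x}) * real (card {x \<in> S. Q i x})) < (\<Sum>i\<in>C. \<beta> / 2 * N\<^sup>2)"
    using fin less by (intro sum_strict_mono) auto
  then have up: "(\<Sum>i\<in>C. real (card {x \<in> S. P i x}) * real (card {x \<in> S. Q i x})) < card C * (\<beta> / 2 * N\<^sup>2)"
    by simp
  have ind: "real (card {x \<in> B. R x}) = (\<Sum>x\<in>B. if R x then 1 else 0)" if "finite B" for B :: "'c set" and R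
    using that by (simp add: sum.If_cases Int_def)
  have ind': "real (card {x \<in> B. R x}) = (\<Sum>x\<in>B. if R x then 1 else 0)" if "finite B" for B :: "'d set" and R
    using that by (simp add: sum.If_cases Int_def)
  have conj: "(if a then 1 else 0) * (if b then 1 else 0) = (if a \<and> b then 1 else (0::real))" for a b
    by simp
  have "(\<Sum>i\<in>C. real (card {x \<in> S. P i x}) * real (card {x \<in> S. Q i x}))
      = (\<Sum>i\<in>C. \<Sum>x\<in>S. \<Sum>y\<in>S. if P i x \<and> Q i y then 1 else 0)"
    using fin by (simp only: ind ind' sum_product conj)
  also have "\<dots> = (\<Sum>x\<in>S. \<Sum>i\<in>C. \<Sum>y\<in>S. if P i x \<and> Q i y then 1 else 0)"
    by (rule sum.swap)
  also have "\<dots> = (\<Sum>x\<in>S. \<Sum>y\<in>S. \<Sum>i\<in>C. if P i x \<and> Q i y then 1 else 0)"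
    by (intro sum.cong refl sum.swap)
  also have "\<dots> = (\<Sum>x\<in>S. \<Sum>y\<in>S. real (card {i \<in> C. P i x \<and> Q i y}))"
    using fin by (simp add: ind ind')
  finally have eq: "(\<Sum>i\<in>C. real (card {x \<in> S. P i x}) * real (card {x \<in> S. Q i x}))
      = (\<Sum>x\<in>S. \<Sum>y\<in>S. real (card {i \<in> C. P i x \<and> Q i y}))" .
  have row: "(N - 1) * (\<beta> * card C) \<le> (\<Sum>y\<in>S. real (card {i \<in> C. P i x \<and> Q i y}))" if x: "x \<in> S" for x
  proof -
    have "(N - 1) * (\<beta> * card C) = (\<Sum>y\<in>S - {x}. \<beta> * card C)"
      using x fin two by (simp add: N_def of_nat_diff)
    also have "\<dots> \<le> (\<Sum>y\<in>S - {x}. real (card {i \<in> C. P i x \<and> Q i y}))"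
      using x by (intro sum_mono sep) auto
    also have "\<dots> \<le> (\<Sum>y\<in>S. real (card {i \<in> C. P i x \<and> Q i y}))"
      using fin by (intro sum_mono2) auto
    finally show ?thesis .
  qed
  have "N * ((N - 1) * (\<beta> * card C)) = (\<Sum>x\<in>S. (N - 1) * (\<beta> * card C))"
    by (simp add: N_def)
  also have "\<dots> \<le> (\<Sum>x\<in>S. \<Sum>y\<in>S. real (card {i \<in> C. P i x \<and> Q i y}))"
    by (intro sum_mono row)
  finally have "N * ((N - 1) * (\<beta> * card C)) < card C * (\<beta> / 2 * N\<^sup>2)"
    using up eq by linarith
  \<comment> \<open>The diagonal pairs are lost, leaving \<open>N - 1\<close> per row. As
    \<open>2 \<le> N\<close> this is at least \<open>N / 2\<close>, which explains the factor
    \<open>1 / 2\<close> in the conclusion.\<close>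
  moreover have "card C * (\<beta> / 2 * N\<^sup>2) \<le> N * ((N - 1) * (\<beta> * card C))"
  proof -
    have "N\<^sup>2 / 2 \<le> N * (N - 1)" using N by (simp add: power2_eq_square field_simps)
    then have "(\<beta> * card C) * (N\<^sup>2 / 2) \<le> (\<beta> * card C) * (N * (N - 1))"
      using \<beta> by (intro mult_left_mono) auto
    then show ?thesis by (simp add: algebra_simps)
  qed
  ultimately show False by linarith
qed

text \<open>Split \<open>S\<close> along a balanced coordinate \<open>i\<close>; each half stays separated on the same number of
  coordinates. Sets shattered by one half are shattered by \<open>S\<close>, and if \<open>W\<close> is shattered by both
  halves then so is \<open>insert i W\<close> by \<open>S\<close>. Hence the number of shattered sets at least doubles
  while the size of the family drops by a constant factor.\<close>

lemma many_shattered_sets: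
  fixes \<beta> :: real
  assumes fin: "finite C" "C \<noteq> {}" and \<beta>: "0 < \<beta>" "\<beta> \<le> 1"
    and disj: "\<And>i x. P i x \<Longrightarrow> \<not> Q i x"
    and "finite S"
    and sep: "\<And>x y. x \<in> S \<Longrightarrow> y \<in> S \<Longrightarrow> x \<noteq> y \<Longrightarrow> \<beta> * card C \<le> card {i \<in> C. P i x \<and> Q i y}"
    and "(2 / \<beta>) ^ j \<le> card S"
  shows "2 ^ j \<le> card {W. W \<subseteq> C \<and> shatters P Q S W}"
  using assms(6-)
proof (induction j arbitrary: S)
  case 0
  then have "S \<noteq> {}" by auto
  then have "{} \<in> {W. W \<subseteq> C \<and> shatters P Q S W}" by (auto simp: shatters_def)
  moreover have "finite {W. W \<subseteq> C \<and> shatters P Q S W}" using fin by simp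
  ultimately have "card {W. W \<subseteq> C \<and> shatters P Q S W} \<noteq> 0" by (metis card_0_eq empty_iff)
  then show ?case by simp
next
  case (Suc j)
  have ge1: "1 \<le> (2 / \<beta>) ^ j" using \<beta> by (intro one_le_power) (simp add: field_simps)
  have "2 \<le> 2 / \<beta>" using \<beta> by (simp add: field_simps)
  then have "2 * 1 \<le> 2 / \<beta> * (2 / \<beta>) ^ j" using ge1 \<beta> by (intro mult_mono) auto
  then have "2 \<le> card S" using Suc.prems(3) by simp
  then obtain i where i: "i \<in> C" and big: "\<beta> / 2 * card S \<le> card {x \<in> S. P i x}"
    "\<beta> / 2 * card S \<le> card {x \<in> S. Q i x}"
    using exists_balanced_coordinate[where P = P and Q = Q, OF fin Suc.prems(1) \<beta>(1) _ Suc.prems(2)]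
    by blast
  have red: "(2 / \<beta>) ^ j \<le> \<beta> / 2 * card S"
    using Suc.prems(3) \<beta> by (simp add: field_simps)
  define A where "A = {W. W \<subseteq> C \<and> shatters P Q {x \<in> S. P i x} W}"
  define B where "B = {W. W \<subseteq> C \<and> shatters P Q {x \<in> S. Q i x} W}"
  have finAB: "finite A" "finite B" using fin by (simp_all add: A_def B_def)
  have A: "2 ^ j \<le> card A"
    unfolding A_def using Suc.prems red big by (intro Suc.IH) auto
  have B: "2 ^ j \<le> card B"
    unfolding B_def using Suc.prems red big by (intro Suc.IH) auto
  \<comment> \<open>On the half where \<open>P i\<close> holds, a shattered set containing
    \<open>i\<close> would require a point with \<open>Q i\<close> for the empty demand.\<close>
  have iA: "i \<notin> W" if "W \<in> A" for W
  proof
    assume "i \<in> W"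
    from that have "shatters P Q {x \<in> S. P i x} W" by (simp add: A_def)
    from shattersD[OF this, of "{}"] obtain x where "P i x" "Q i x" using \<open>i \<in> W\<close> by auto
    then show False using disj by blast
  qed
  have inj: "inj_on (insert i) (A \<inter> B)"
    using iA by (intro inj_onI) (metis IntD1 insert_ident)
  have disjoint: "(A \<union> B) \<inter> insert i ` (A \<inter> B) = {}"
  proof -
    have "i \<notin> W" if "W \<in> B" for W
    proof
      assume "i \<in> W"
      from that have "shatters P Q {x \<in> S. Q i x} W" by (simp add: B_def)
      from shattersD[OF this, of W] obtain x where "P i x" "Q i x" using \<open>i \<in> W\<close> by auto
      then show False using disj by blast
    qed
    with iA show ?thesis by auto
  qed
  \<comment> \<open>Sets shattered by both halves count twice, the second time through
    \<open>insert i\<close>, which lands among sets containing \<open>i\<close> and hence outside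
    \<open>A \<union> B\<close>.\<close>
  have "card A + card B = card (A \<union> B) + card (A \<inter> B)"
    using finAB by (rule card_Un_Int)
  also have "card (A \<inter> B) = card (insert i ` (A \<inter> B))"
    using inj by (simp add: card_image)
  also have "card (A \<union> B) + \<dots> = card ((A \<union> B) \<union> insert i ` (A \<inter> B))"
    using finAB disjoint by (intro card_Un_disjoint[symmetric]) auto
  also have "\<dots> \<le> card {W. W \<subseteq> C \<and> shatters P Q S W}"
  proof (rule card_mono)
    show "finite {W. W \<subseteq> C \<and> shatters P Q S W}" using fin by simp
    have "W \<subseteq> C \<and> shatters P Q S W" if "W \<in> A \<union> B" for W
      using that by (auto simp: A_def B_def intro: shatters_mono_set)
    moreover have "insert i W \<subseteq> C \<and> shatters P Q S (insert i W)" if "W \<in> A \<inter> B" for W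
      using that i by (auto simp: A_def B_def intro: shatters_insert)
    ultimately show "(A \<union> B) \<union> insert i ` (A \<inter> B) \<subseteq> {W. W \<subseteq> C \<and> shatters P Q S W}"
      by blast
  qed
  finally show ?case using A B by simp
qed

lemma sum_power_card_Pow:
  fixes t :: "'a::comm_semiring_1"
  assumes "finite C"
  shows "(\<Sum>W\<in>Pow C. t ^ card W) = (1 + t) ^ card C"
  using prod_add[OF assms, of "\<lambda>_. t" "\<lambda>_. 1"] by (simp add: add.commute)

text \<open>Give each \<open>W\<close> the weight \<open>t ^ card W\<close>. As
  \<open>t \<le> 1\<close>, each set counted weighs at least \<open>t ^ d\<close>, while all subsets
  together weigh \<open>(1 + t) ^ card C\<close>.\<close>

lemma card_small_subsets_le:
  fixes t :: real
  assumes "finite C" "0 < t" "t \<le> 1"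
  shows "card {W. W \<subseteq> C \<and> card W \<le> d} * t ^ d \<le> exp (t * card C)"
proof -
  have "card {W. W \<subseteq> C \<and> card W \<le> d} * t ^ d = (\<Sum>W | W \<subseteq> C \<and> card W \<le> d. t ^ d)"
    by simp
  also have "\<dots> \<le> (\<Sum>W | W \<subseteq> C \<and> card W \<le> d. t ^ card W)"
    using assms by (intro sum_mono power_decreasing) auto
  also have "\<dots> \<le> (\<Sum>W\<in>Pow C. t ^ card W)"
    using assms by (intro sum_mono2) auto
  also have "\<dots> = (1 + t) ^ card C" by (rule sum_power_card_Pow) fact
  also have "\<dots> \<le> exp t ^ card C"
    using assms by (intro power_mono exp_ge_add_one_self) auto
  also have "\<dots> = exp (t * card C)"
    by (simp add: exp_of_nat2_mult)
  finally show ?thesis .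
qed

text \<open>Used twice: to bound the loss when a separated set is thinned out, and to show that
  exponentially many shattered sets cannot all be small.\<close>

lemma card_small_subsets_subexponential:
  fixes \<eta> :: real and m :: nat
  assumes "0 < \<eta>"
  obtains \<alpha> :: real where "0 < \<alpha>" "\<alpha> \<le> 1"
    "\<And>(C :: 'i set) n d. finite C \<Longrightarrow> card C \<le> n * m \<Longrightarrow> real d \<le> \<alpha> * real n \<Longrightarrow>
       card {W. W \<subseteq> C \<and> card W \<le> d} \<le> exp (\<eta> * n)"
proof -
  \<comment> \<open>The exponent to be bounded is \<open>t * card C - d * ln t\<close>. The choice
    of \<open>t\<close> keeps the first term below half of \<open>\<eta> * n\<close>, then
    \<open>\<alpha>\<close> does the same for the second. The forms \<open>m + 1\<close> and
    \<open>1 - ln t\<close> avoid division by zero.\<close>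
  define t where "t = min 1 (\<eta> / (2 * (m + 1)))"
  define \<alpha> where "\<alpha> = min 1 (\<eta> / (2 * (1 - ln t)))"
  have t: "0 < t" "t \<le> 1" using assms by (auto simp: t_def)
  then have ln: "ln t \<le> 0" by simp
  have tm: "t * m \<le> \<eta> / 2"
  proof -
    have "t * m \<le> \<eta> / (2 * (m + 1)) * m" by (intro mult_right_mono) (auto simp: t_def)
    also have "\<dots> \<le> \<eta> / 2" using assms by (simp add: field_simps)
    finally show ?thesis .
  qed
  have \<alpha>: "0 < \<alpha>" "\<alpha> \<le> 1" using assms ln by (auto simp: \<alpha>_def)
  have \<alpha>t: "\<alpha> * - ln t \<le> \<eta> / 2"
  proof -
    have "\<alpha> * - ln t \<le> \<eta> / (2 * (1 - ln t)) * - ln t"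
      using ln by (intro mult_right_mono) (auto simp: \<alpha>_def)
    also have "\<dots> \<le> \<eta> / 2" using assms ln by (simp add: field_simps)
    finally show ?thesis .
  qed
  show thesis
  proof (rule that[OF \<alpha>])
    fix C :: "'i set" and n d :: nat
    assume C: "finite C" "card C \<le> n * m" and d: "real d \<le> \<alpha> * n"
    have "card {W. W \<subseteq> C \<and> card W \<le> d} = card {W. W \<subseteq> C \<and> card W \<le> d} * t ^ d * exp (d * - ln t)"
      using t by (simp add: exp_minus exp_of_nat_mult)
    also have "\<dots> \<le> exp (t * card C) * exp (d * - ln t)"
      using card_small_subsets_le[OF C(1) t] by (intro mult_right_mono) auto
    also have "\<dots> = exp (t * card C + d * - ln t)" by (rule exp_add[symmetric])
    also have "\<dots> \<le> exp (\<eta> * n)"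
    proof -
      have "t * card C \<le> t * (n * m)" using C t by (intro mult_left_mono) (auto simp flip: of_nat_mult)
      also have "\<dots> = n * (t * m)" by simp
      also have "\<dots> \<le> n * (\<eta> / 2)" using tm by (intro mult_left_mono) auto
      finally have 1: "t * card C \<le> n * (\<eta> / 2)" .
      have "d * - ln t \<le> \<alpha> * n * - ln t" using d ln by (intro mult_right_mono) auto
      also have "\<dots> = n * (\<alpha> * - ln t)" by simp
      also have "\<dots> \<le> n * (\<eta> / 2)" using \<alpha>t by (intro mult_left_mono) auto
      finally have 2: "d * - ln t \<le> n * (\<eta> / 2)" .
      have "n * (\<eta> / 2) + n * (\<eta> / 2) = \<eta> * n" by (simp add: algebra_simps)
      with 1 2 show ?thesis by (simp add: algebra_simps)
    qed
    finally show "card {W. W \<subseteq> C \<and> card W \<le> d} \<le> exp (\<eta> * n)" .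
  qed
qed

section \<open>Independence along orbits and its compactness\<close>

section \<open>Independence sets\<close>

locale compact_dynamics =
  fixes f :: "'a::metric_space \<Rightarrow> 'a" and X :: "'a set"
  assumes compact: "compact X" and continuous: "continuous_on X f" and invariant: "f ` X \<subseteq> X"
begin

lemma funpow_in: "x \<in> X \<Longrightarrow> (f ^^ n) x \<in> X"
  using invariant by (induction n) auto

lemma continuous_on_funpow: "continuous_on X (f ^^ n)"
proof (induction n)
  case 0
  then show ?case by (simp add: id_def)
next
  case (Suc n)
  have "(f ^^ n) ` X \<subseteq> X" using funpow_in by blast
  then have "continuous_on X (f \<circ> (f ^^ n))"
    using Suc continuous continuous_on_compose continuous_on_subset by blast
  then show ?case by simp
qed

lemma tendsto_funpow:
  assumes "\<And>k. u k \<in> X" "u \<longlonglongrightarrow> y" "y \<in> X"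
  shows "(\<lambda>k. (f ^^ n) (u k)) \<longlonglongrightarrow> (f ^^ n) y"
  using continuous_on_tendsto_compose[OF continuous_on_funpow assms(2,3)] assms(1) by simp

lemma restrict:
  assumes "compact Z" "Z \<subseteq> X" "f ` Z \<subseteq> Z"
  shows "compact_dynamics f Z"
  using assms continuous continuous_on_subset by unfold_locales blast+

end

text \<open>\<open>J\<close> is an independence set for the closed ball of radius \<open>r\<close>
  about \<open>p\<close> and the complement of the open ball of radius \<open>2 * r\<close>. Both
  sets are closed, so demands survive limits, and they are at least \<open>r\<close> apart.\<close>

definition independent :: "('a::metric_space \<Rightarrow> 'a) \<Rightarrow> 'a \<Rightarrow> real \<Rightarrow> 'a set \<Rightarrow> nat set \<Rightarrow> bool" where
  "independent f p r Z J \<longleftrightarrow>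
     shatters (\<lambda>j x. dist p ((f ^^ j) x) \<le> r) (\<lambda>j x. 2 * r \<le> dist p ((f ^^ j) x)) Z J"

lemma independentD:
  assumes "independent f p r Z J" "I \<subseteq> J"
  obtains x where "x \<in> Z" "\<And>j. j \<in> I \<Longrightarrow> dist p ((f ^^ j) x) \<le> r"
    "\<And>j. j \<in> J - I \<Longrightarrow> 2 * r \<le> dist p ((f ^^ j) x)"
  using assms unfolding independent_def by (rule shattersD) (use that in blast)

lemma independentI:
  assumes "\<And>I. I \<subseteq> J \<Longrightarrow> \<exists>x\<in>Z. (\<forall>j\<in>I. dist p ((f ^^ j) x) \<le> r) \<and> (\<forall>j\<in>J - I. 2 * r \<le> dist p ((f ^^ j) x))"
  shows "independent f p r Z J"
  using assms unfolding independent_def shatters_def by blast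

lemma independent_subset: "independent f p r Z J \<Longrightarrow> I \<subseteq> J \<Longrightarrow> independent f p r Z I"
  unfolding independent_def by (rule shatters_subset)

lemma independent_mono: "independent f p r Z J \<Longrightarrow> Z \<subseteq> Y \<Longrightarrow> independent f p r Y J"
  unfolding independent_def by (rule shatters_mono_set)

context compact_dynamics
begin

text \<open>If \<open>x\<close> meets the demand translated by \<open>m\<close>, then
  \<open>(f ^^ m) x\<close> meets the original one.\<close>

lemma independent_shift:
  assumes "independent f p r X J"
  shows "independent f p r X {j. j + m \<in> J}"
proof (rule independentI)
  fix I assume I: "I \<subseteq> {j. j + m \<in> J}"
  then have "(\<lambda>j. j + m) ` I \<subseteq> J" by auto
  from independentD[OF assms this] obtain x where x: "x \<in> X"
    "\<And>j. j \<in> (\<lambda>j. j + m) ` I \<Longrightarrow> dist p ((f ^^ j) x) \<le> r"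
    "\<And>j. j \<in> J - (\<lambda>j. j + m) ` I \<Longrightarrow> 2 * r \<le> dist p ((f ^^ j) x)" by blast
  have eq: "(f ^^ j) ((f ^^ m) x) = (f ^^ (j + m)) x" for j by (simp add: funpow_add)
  show "\<exists>x\<in>X. (\<forall>j\<in>I. dist p ((f ^^ j) x) \<le> r) \<and> (\<forall>j\<in>{j. j + m \<in> J} - I. 2 * r \<le> dist p ((f ^^ j) x))"
  proof (intro bexI[of _ "(f ^^ m) x"] conjI ballI)
    show "(f ^^ m) x \<in> X" using x(1) by (rule funpow_in)
    show "dist p ((f ^^ j) ((f ^^ m) x)) \<le> r" if "j \<in> I" for j
      unfolding eq using that by (intro x(2)) auto
    show "2 * r \<le> dist p ((f ^^ j) ((f ^^ m) x))" if "j \<in> {j. j + m \<in> J} - I" for j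
      unfolding eq using that by (intro x(3)) auto
  qed
qed

lemma closed_near: "closed {x \<in> X. dist p ((f ^^ j) x) \<le> r}"
  using compact_imp_closed[OF compact] continuous_on_funpow
  by (intro continuous_closed_preimage[of X "\<lambda>x. dist p ((f ^^ j) x)" "{..r}", unfolded vimage_def Int_def, simplified]
    continuous_intros) auto

lemma closed_far: "closed {x \<in> X. r \<le> dist p ((f ^^ j) x)}"
  using compact_imp_closed[OF compact] continuous_on_funpow
  by (intro continuous_closed_preimage[of X "\<lambda>x. dist p ((f ^^ j) x)" "{r..}", unfolded vimage_def Int_def, simplified]
    continuous_intros) auto

definition pattern :: "'a \<Rightarrow> real \<Rightarrow> nat set \<Rightarrow> nat set \<Rightarrow> 'a set" where
  "pattern p r I J = {x \<in> X. (\<forall>j\<in>I. dist p ((f ^^ j) x) \<le> r) \<and> (\<forall>j\<in>J - I. 2 * r \<le> dist p ((f ^^ j) x))}"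

lemma closed_pattern: "closed (pattern p r I J)"
proof -
  have "pattern p r I J = X \<inter> (\<Inter>j\<in>I. {x \<in> X. dist p ((f ^^ j) x) \<le> r}) \<inter> (\<Inter>j\<in>J - I. {x \<in> X. 2 * r \<le> dist p ((f ^^ j) x)})"
    by (auto simp: pattern_def)
  also have "closed \<dots>"
    using closed_near closed_far compact_imp_closed[OF compact]
    by (intro closed_Int closed_INT ballI) auto
  finally show ?thesis .
qed

text \<open>For a fixed demand, meeting it before time \<open>n\<close> is a closed condition that
  gets stronger as \<open>n\<close> grows, so the finite intersection property supplies a point
  meeting it at all times.\<close>

lemma independent_compactness:
  assumes "\<And>n. independent f p r X (J \<inter> {..<n})"
  shows "independent f p r X J"
proof (rule independentI)
  fix I assume I: "I \<subseteq> J"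
  define K where "K n = pattern p r (I \<inter> {..<n}) (J \<inter> {..<n})" for n
  have "X \<inter> (\<Inter>n\<in>UNIV. K n) \<noteq> {}"
  proof (rule compact_imp_fip_image[OF compact])
    show "closed (K n)" for n unfolding K_def by (rule closed_pattern)
    fix N :: "nat set" assume "finite N"
    then obtain n where n: "\<And>k. k \<in> N \<Longrightarrow> k \<le> n" using Max_ge by blast
    have "I \<inter> {..<n} \<subseteq> J \<inter> {..<n}" using I by blast
    from independentD[OF assms this] obtain x where "x \<in> X"
      "\<And>j. j \<in> I \<inter> {..<n} \<Longrightarrow> dist p ((f ^^ j) x) \<le> r"
      "\<And>j. j \<in> J \<inter> {..<n} - I \<inter> {..<n} \<Longrightarrow> 2 * r \<le> dist p ((f ^^ j) x)" by blast
    then have "x \<in> X \<inter> (\<Inter>k\<in>N. K k)"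
      using n by (fastforce simp: K_def pattern_def)
    then show "X \<inter> (\<Inter>k\<in>N. K k) \<noteq> {}" by blast
  qed
  then obtain x where x: "x \<in> X" "\<And>n. x \<in> K n" by blast
  have "dist p ((f ^^ j) x) \<le> r" if "j \<in> I" for j
    using x(2)[of "Suc j"] that by (auto simp: K_def pattern_def)
  moreover have "2 * r \<le> dist p ((f ^^ j) x)" if "j \<in> J - I" for j
    using x(2)[of "Suc j"] that by (auto simp: K_def pattern_def)
  ultimately show "\<exists>x\<in>X. (\<forall>j\<in>I. dist p ((f ^^ j) x) \<le> r) \<and> (\<forall>j\<in>J - I. 2 * r \<le> dist p ((f ^^ j) x))"
    using x(1) by blast
qed

end

section \<open>Dense sets of times and the passage to one infinite set\<close>

text \<open>Otherwise \<open>J\<close> can be cut from left to right into blocks of length at most \<open>l\<close> and density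
  less than \<open>\<delta>'\<close>.\<close>

lemma exists_dense_shift:
  fixes J :: "nat set" and \<delta> \<delta>' :: real and l N :: nat
  assumes "\<delta>' < \<delta>" "0 \<le> \<delta>'" and J: "J \<subseteq> {..<N}" "\<delta> * N \<le> card J" and N: "l < (\<delta> - \<delta>') * N"
  obtains m where "\<And>k. k \<le> l \<Longrightarrow> \<delta>' * k \<le> card ({j. j + m \<in> J} \<inter> {..<k})"
proof (rule ccontr)
  assume "\<not> thesis"
  have bad: "\<exists>k\<le>l. card ({j. j + m \<in> J} \<inter> {..<k}) < \<delta>' * k" for m
  proof (rule ccontr)
    assume "\<not> ?thesis"
    then have "\<delta>' * k \<le> card ({j. j + m \<in> J} \<inter> {..<k})" if "k \<le> l" for k
      using that by (simp add: not_less)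
    then have thesis by (rule that)
    with \<open>\<not> thesis\<close> show False ..
  qed
  have fin: "finite J" using J(1) finite_subset by blast
  \<comment> \<open>In the induction a block is appended only when the cut point is exactly
    \<open>n\<close>; otherwise the same \<open>t\<close> still serves for
    \<open>Suc n\<close>.\<close>
  have cut: "\<exists>t. n \<le> t \<and> t \<le> n + l \<and> card (J \<inter> {..<t}) \<le> \<delta>' * t" for n :: nat
  proof (induction n)
    case 0
    show ?case by (intro exI[of _ 0]) simp
  next
    case (Suc n)
    then obtain t where t: "n \<le> t" "t \<le> n + l" "card (J \<inter> {..<t}) \<le> \<delta>' * t" by blast
    show ?case
    proof (cases "t = n")
      case False
      with t show ?thesis by (intro exI[of _ t]) auto
    next
      case True
      from bad[of t] obtain k where k: "k \<le> l" "card ({j. j + t \<in> J} \<inter> {..<k}) < \<delta>' * k" by blast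
      \<comment> \<open>The strict inequality excludes an empty block, so the cut point moves past
        \<open>n\<close>.\<close>
      have "k \<noteq> 0" using k(2) by (intro notI) simp
      have "J \<inter> {..<t + k} = (J \<inter> {..<t}) \<union> (\<lambda>j. j + t) ` ({j. j + t \<in> J} \<inter> {..<k})"
      proof (intro equalityI subsetI)
        fix j assume j: "j \<in> J \<inter> {..<t + k}"
        show "j \<in> (J \<inter> {..<t}) \<union> (\<lambda>j. j + t) ` ({j. j + t \<in> J} \<inter> {..<k})"
        proof (cases "j < t")
          case False
          then have "j = (j - t) + t" by simp
          then show ?thesis using j False by (intro UnI2 image_eqI[of _ _ "j - t"]) auto
        qed (use j in auto)
      qed auto
      then have "card (J \<inter> {..<t + k}) \<le> card (J \<inter> {..<t}) + card ((\<lambda>j. j + t) ` ({j. j + t \<in> J} \<inter> {..<k}))"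
        by (metis card_Un_le)
      also have "\<dots> \<le> card (J \<inter> {..<t}) + card ({j. j + t \<in> J} \<inter> {..<k})"
        by (intro add_left_mono card_image_le) auto
      finally have "real (card (J \<inter> {..<t + k})) \<le> \<delta>' * t + \<delta>' * k"
        using t(3) k(2) by linarith
      then show ?thesis using True k(1) \<open>k \<noteq> 0\<close>
        by (intro exI[of _ "t + k"]) (auto simp: algebra_simps)
    qed
  qed
  \<comment> \<open>A cut point beyond \<open>N\<close> has all of \<open>J\<close> before it. This
    forces \<open>(\<delta> - \<delta>') * N \<le> \<delta>' * l\<close>, which contradicts the size
    of \<open>N\<close> because \<open>\<delta> \<le> 1\<close>.\<close>
  from cut[of N] obtain t where t: "N \<le> t" "t \<le> N + l" "card (J \<inter> {..<t}) \<le> \<delta>' * t" by blast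
  have "J \<inter> {..<t} = J" using J(1) t(1) by auto
  then have "\<delta> * N \<le> \<delta>' * t" using t(3) J(2) by simp
  also have "\<dots> \<le> \<delta>' * (N + l)" using t(2) assms(2) by (intro mult_left_mono) auto
  finally have *: "(\<delta> - \<delta>') * N \<le> \<delta>' * l" by (simp add: algebra_simps)
  show False
  proof (cases "N = 0")
    case True
    then show False using N by simp
  next
    case False
    have "\<delta> * N \<le> 1 * N" using J card_mono[of "{..<N}" J] by simp
    then have "\<delta> \<le> 1" using False by simp
    then have "\<delta>' * l \<le> 1 * real l" using assms(1) by (intro mult_right_mono) auto
    with * N show False by simp
  qed
qed

text \<open>Compactness of the Cantor space: \<open>K\<close> is a cluster point of the sequence
  \<open>J\<close>. Initial segments are fixed one after the other, the pigeonhole principle keeping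
  infinitely many indices each time.\<close>

lemma subset_compactness:
  fixes J :: "nat \<Rightarrow> nat set"
  obtains K where "\<And>l. infinite {L. J L \<inter> {..<l} = K \<inter> {..<l}}"
proof -
  have "\<exists>F. \<forall>n. (F n \<subseteq> {..<n} \<and> infinite {L. J L \<inter> {..<n} = F n}) \<and> F (Suc n) \<inter> {..<n} = F n"
  proof (rule dependent_nat_choice)
    show "\<exists>F\<subseteq>{..<0}. infinite {L. J L \<inter> {..<0} = F}" by simp
    fix F n assume F: "F \<subseteq> {..<n} \<and> infinite {L. J L \<inter> {..<n} = F}"
    have "finite ((\<lambda>L. J L \<inter> {..<Suc n}) ` {L. J L \<inter> {..<n} = F})"
      by (rule finite_subset[of _ "Pow {..<Suc n}"]) auto
    from pigeonhole_infinite[OF conjunct2[OF F] this]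
    obtain L0 where L0: "J L0 \<inter> {..<n} = F"
      "infinite {L \<in> {L. J L \<inter> {..<n} = F}. J L \<inter> {..<Suc n} = J L0 \<inter> {..<Suc n}}"
      by auto
    have "infinite {L. J L \<inter> {..<Suc n} = J L0 \<inter> {..<Suc n}}"
      using L0(2) by (rule contrapos_nn) (auto elim: rev_finite_subset)
    then show "\<exists>G. (G \<subseteq> {..<Suc n} \<and> infinite {L. J L \<inter> {..<Suc n} = G}) \<and> G \<inter> {..<n} = F"
      using L0(1) by (intro exI[of _ "J L0 \<inter> {..<Suc n}"]) auto
  qed
  then obtain F where F: "\<And>n. F n \<subseteq> {..<n}" "\<And>n. infinite {L. J L \<inter> {..<n} = F n}"
    "\<And>n. F (Suc n) \<inter> {..<n} = F n" by blast
  \<comment> \<open>The segment of length \<open>Suc j\<close> is the first that decides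
    \<open>j\<close>; reading it there glues the compatible \<open>F n\<close> into one set.\<close>
  have eq: "{j. j \<in> F (Suc j)} \<inter> {..<n} = F n" for n
  proof (induction n)
    case 0
    then show ?case using F(1)[of 0] by simp
  next
    case (Suc n)
    have "F (Suc n) = F n \<union> (F (Suc n) \<inter> {n})"
      using F(1)[of "Suc n"] F(3)[of n] by (auto simp: lessThan_Suc)
    also have "\<dots> = {j. j \<in> F (Suc j)} \<inter> {..<Suc n}"
      unfolding Suc.IH[symmetric] by (auto simp: lessThan_Suc)
    finally show ?case ..
  qed
  show ?thesis
    by (rule that[of "{j. j \<in> F (Suc j)}"]) (simp only: eq F(2) not_False_eq_True)
qed

text \<open>\<open>F\<close> may vary with \<open>n\<close>. For each \<open>n\<close> only finitely
  many \<open>F\<close> compete, which lets the property pass to intersections of chains.\<close>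

definition independence_density :: "('a::metric_space \<Rightarrow> 'a) \<Rightarrow> 'a \<Rightarrow> real \<Rightarrow> real \<Rightarrow> 'a set \<Rightarrow> bool" where
  "independence_density f p r \<delta> Z \<longleftrightarrow>
     (\<forall>n. \<exists>F\<subseteq>{..<n}. \<delta> * real n \<le> real (card F) \<and> independent f p r Z F)"

context compact_dynamics
begin

text \<open>An independence set dense in one long enough interval is translated so that all its
  initial segments up to \<open>l\<close> are dense; the translate is still independent.\<close>

lemma independent_dense_upto:
  fixes \<delta> \<delta>' :: real and l :: nat
  assumes freq: "\<exists>\<^sub>F n in sequentially. \<exists>F\<subseteq>{..<n}. \<delta> * real n \<le> real (card F) \<and> independent f p r X F"
    and "0 \<le> \<delta>'" "\<delta>' < \<delta>"
  obtains J where "independent f p r X J" "\<And>k. k \<le> l \<Longrightarrow> \<delta>' * k \<le> card (J \<inter> {..<k})"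
proof -
  obtain N0 :: nat where N0: "l < (\<delta> - \<delta>') * N0"
    using assms(3) reals_Archimedean3[of "\<delta> - \<delta>'"] by (auto simp: mult.commute)
  from freq obtain N F where N: "N \<ge> N0" and F: "F \<subseteq> {..<N}" "\<delta> * N \<le> card F" "independent f p r X F"
    unfolding frequently_sequentially by blast
  have "(\<delta> - \<delta>') * N0 \<le> (\<delta> - \<delta>') * N" using N assms(3) by (intro mult_left_mono) auto
  with N0 have "l < (\<delta> - \<delta>') * N" by linarith
  from exists_dense_shift[OF assms(3,2) F(1,2) this]
  obtain m where "\<And>k. k \<le> l \<Longrightarrow> \<delta>' * k \<le> card ({j. j + m \<in> F} \<inter> {..<k})" by blast
  with independent_shift[OF F(3), of m] show ?thesis by (rule that)
qed

text \<open>Entropy yields dense independence sets only for infinitely many \<open>n\<close>; a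
  small loss of density gives them for every \<open>n\<close>.\<close>

lemma independence_density_of_frequently:
  fixes \<delta> \<delta>' :: real
  assumes freq: "\<exists>\<^sub>F n in sequentially. \<exists>F\<subseteq>{..<n}. \<delta> * real n \<le> real (card F) \<and> independent f p r X F"
    and "0 \<le> \<delta>'" "\<delta>' < \<delta>"
  shows "independence_density f p r \<delta>' X"
  unfolding independence_density_def
proof
  fix n
  obtain J where J: "independent f p r X J" "\<And>k. k \<le> n \<Longrightarrow> \<delta>' * k \<le> card (J \<inter> {..<k})"
    using independent_dense_upto[OF assms] by metis
  then show "\<exists>F\<subseteq>{..<n}. \<delta>' * n \<le> card F \<and> independent f p r X F"
    by (intro exI[of _ "J \<inter> {..<n}"]) (auto intro: independent_subset)
qed

text \<open>Sets of density \<open>\<delta> * (1 - 1 / Suc L)\<close> up to \<open>L\<close> cluster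
  at a set of density \<open>\<delta>\<close>. Keeping \<open>\<delta>\<close> exact lets an
  omega-limit set be compared later with a minimal subsystem of the same density.\<close>

lemma infinite_independent_set:
  fixes \<delta> :: real
  assumes "0 < \<delta>" and dens: "independence_density f p r \<delta> X"
  obtains J where "independent f p r X J" "\<And>k. \<delta> * k \<le> card (J \<inter> {..<k})"
proof -
  have scale: "a * (1 - 1 / s) * b * s = a * b * s - a * b" if "s \<noteq> 0" for a b s :: real
    using that by (simp add: field_simps)
  have freq: "\<exists>\<^sub>F n in sequentially. \<exists>F\<subseteq>{..<n}. \<delta> * real n \<le> real (card F) \<and> independent f p r X F"
    using dens unfolding independence_density_def by (intro eventually_frequently) auto
  have "\<exists>J. independent f p r X J \<and> (\<forall>k\<le>L. \<delta> * (1 - 1 / Suc L) * k \<le> card (J \<inter> {..<k}))" for L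
  proof -
    have "0 \<le> \<delta> * (1 - 1 / Suc L)" "\<delta> * (1 - 1 / Suc L) < \<delta>"
      using assms(1) by (auto simp: field_simps)
    from independent_dense_upto[OF freq this] show ?thesis by metis
  qed
  then obtain J where J: "\<And>L. independent f p r X (J L)"
    "\<And>L k. k \<le> L \<Longrightarrow> \<delta> * (1 - 1 / Suc L) * k \<le> card (J L \<inter> {..<k})" by metis
  obtain K where K: "\<And>l. infinite {L. J L \<inter> {..<l} = K \<inter> {..<l}}"
    using subset_compactness by blast
  show thesis
  proof (rule that[of K])
    show "independent f p r X K"
    proof (rule independent_compactness)
      fix n
      from K[of n] obtain L where "J L \<inter> {..<n} = K \<inter> {..<n}"
        using not_finite_existsD by blast
      with J(1)[of L] show "independent f p r X (K \<inter> {..<n})"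
        by (metis Int_lower1 independent_subset)
    qed
    fix k
    show "\<delta> * k \<le> card (K \<inter> {..<k})"
    proof (rule ccontr)
      assume "\<not> ?thesis"
      then have pos: "0 < \<delta> * k - card (K \<inter> {..<k})" by simp
      \<comment> \<open>The shortfall of \<open>K\<close> at \<open>k\<close> is a fixed positive
        number, while that of \<open>J L\<close> is at most \<open>\<delta> * k / Suc L\<close>; a
        large \<open>L\<close> that agrees with \<open>K\<close> below \<open>k\<close> is
        contradictory.\<close>
      obtain L0 :: nat where L0: "\<delta> * k < (\<delta> * k - card (K \<inter> {..<k})) * L0"
        using reals_Archimedean3[OF pos] by (auto simp: mult.commute)
      from K[of k] obtain L where L: "L \<ge> max k L0" "J L \<inter> {..<k} = K \<inter> {..<k}"
        unfolding infinite_nat_iff_unbounded_le by blast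
      then have "\<delta> * (1 - 1 / Suc L) * k \<le> card (K \<inter> {..<k})" using J(2)[of k L] by simp
      then have "\<delta> * (1 - 1 / Suc L) * k * Suc L \<le> card (K \<inter> {..<k}) * real (Suc L)"
        by (rule mult_right_mono) simp
      moreover have "\<delta> * (1 - 1 / Suc L) * k * Suc L = \<delta> * k * Suc L - \<delta> * k"
        by (rule scale) simp
      ultimately have "(\<delta> * k - card (K \<inter> {..<k})) * Suc L \<le> \<delta> * k"
        by (simp only: left_diff_distrib)
      moreover have "(\<delta> * k - card (K \<inter> {..<k})) * L0 \<le> (\<delta> * k - card (K \<inter> {..<k})) * Suc L"
        using pos L(1) by (intro mult_left_mono) auto
      ultimately show False using L0 by linarith
    qed
  qed
qed

end

section \<open>From exponentially many separated orbits to independence of positive density\<close>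

section \<open>Positive entropy\<close>

context compact_dynamics
begin

lemma finite_net_label:
  assumes "0 < r"
  obtains C l where "finite C" "\<And>x. x \<in> X \<Longrightarrow> l x \<in> C" "\<And>x. x \<in> X \<Longrightarrow> dist (l x) x < r"
proof -
  obtain C where C: "finite C" "X \<subseteq> (\<Union>c\<in>C. ball c r)"
    using seq_compact_imp_totally_bounded[OF compact_imp_seq_compact[OF compact]] assms by meson
  then have "\<forall>x\<in>X. \<exists>c\<in>C. dist c x < r" by (auto simp: subset_eq)
  then obtain l where "\<And>x. x \<in> X \<Longrightarrow> l x \<in> C \<and> dist (l x) x < r" by metis
  with C(1) that[of C l] show ?thesis by blast
qed

text \<open>The code of a point lists the cells of its orbit at the at most \<open>d\<close> times at which it is far
  from \<open>t\<close>. It is injective, since two points that are both near \<open>t\<close> at time \<open>k\<close> are not separated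
  at time \<open>k\<close>.\<close>

lemma card_separated_near:
  assumes sep: "separated f n e S" and S: "S \<subseteq> X"
    and C: "finite C" "\<And>x. x \<in> X \<Longrightarrow> l x \<in> C" "\<And>x. x \<in> X \<Longrightarrow> dist (l x) x < e / 8"
  shows "card {s \<in> S. card {k. k < n \<and> e / 2 < dist ((f ^^ k) t) ((f ^^ k) s)} \<le> d}
      \<le> card {W. W \<subseteq> {..<n} \<times> C \<and> card W \<le> d}" (is "card ?B \<le> _")
proof -
  define far where "far s = {k. k < n \<and> e / 2 < dist ((f ^^ k) t) ((f ^^ k) s)}" for s
  define code where "code s = (\<lambda>k. (k, l ((f ^^ k) s))) ` far s" for s
  \<comment> \<open>Equal labels give a distance below \<open>e / 4\<close>. The label bound at an
    orbit point also shows \<open>0 < e\<close>.\<close>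
  have same_cell: "dist ((f ^^ k) s) ((f ^^ k) s') \<le> e" if "s \<in> S" "s' \<in> S" "l ((f ^^ k) s) = l ((f ^^ k) s')" for s s' k
  proof -
    have "(f ^^ k) s \<in> X" "(f ^^ k) s' \<in> X" using that S by (auto intro: funpow_in)
    from C(3)[OF this(1)] C(3)[OF this(2)] that(3)
    have "dist (l ((f ^^ k) s)) ((f ^^ k) s) < e / 8" "dist (l ((f ^^ k) s)) ((f ^^ k) s') < e / 8"
      by simp_all
    then show ?thesis
      using dist_triangle3[of "(f ^^ k) s" "(f ^^ k) s'" "l ((f ^^ k) s)"]
        zero_le_dist[of "l ((f ^^ k) s)" "(f ^^ k) s"] by linarith
  qed
  have inj: "inj_on code ?B"
  proof (rule inj_onI, rule ccontr)
    fix s s' assume s: "s \<in> ?B" "s' \<in> ?B" "code s = code s'" and "s \<noteq> s'"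
    then obtain k where k: "k < n" "e < dist ((f ^^ k) s) ((f ^^ k) s')"
      using sep unfolding separated_def by blast
    have not_far: False if "u \<in> S" "v \<in> S" "code u = code v" "k \<in> far u" "e < dist ((f ^^ k) u) ((f ^^ k) v)" for u v
    proof -
      from that(3,4) have "(k, l ((f ^^ k) u)) \<in> code v" by (auto simp: code_def)
      then have "l ((f ^^ k) u) = l ((f ^^ k) v)" by (auto simp: code_def)
      from same_cell[OF that(1,2) this] that(5) show ?thesis by simp
    qed
    have S': "s \<in> S" "s' \<in> S" and k': "e < dist ((f ^^ k) s') ((f ^^ k) s)"
      using s(1,2) k(2) by (simp_all add: dist_commute)
    have "k \<notin> far s" using not_far[OF S' s(3) _ k(2)] by blast
    moreover have "k \<notin> far s'" using not_far[OF S'(2,1) s(3)[symmetric] _ k'] by blast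
    ultimately have "dist ((f ^^ k) t) ((f ^^ k) s) \<le> e / 2" "dist ((f ^^ k) t) ((f ^^ k) s') \<le> e / 2"
      using k(1) by (auto simp: far_def)
    then show False using k(2) dist_triangle3[of "(f ^^ k) s" "(f ^^ k) s'" "(f ^^ k) t"] by linarith
  qed
  have sub: "code ` ?B \<subseteq> {W. W \<subseteq> {..<n} \<times> C \<and> card W \<le> d}"
  proof (rule image_subsetI)
    fix s assume s: "s \<in> ?B"
    have "finite (far s)" by (simp add: far_def)
    then have "card (code s) \<le> card (far s)" unfolding code_def by (rule card_image_le)
    moreover have "code s \<subseteq> {..<n} \<times> C"
      using s S by (auto simp: code_def far_def intro!: C(2) funpow_in)
    ultimately show "code s \<in> {W. W \<subseteq> {..<n} \<times> C \<and> card W \<le> d}"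
      using s by (simp add: far_def)
  qed
  have fin: "finite {W. W \<subseteq> {..<n} \<times> C \<and> card W \<le> d}" using C(1) by simp
  show "card ?B \<le> card {W. W \<subseteq> {..<n} \<times> C \<and> card W \<le> d}"
    using card_mono[OF fin sub] inj by (simp add: card_image)
qed

text \<open>The bound is \<open>card_separated_near\<close> with \<open>d = n\<close>, a restriction
  that every point meets; a bounded nonempty set of naturals attains its \<open>Sup\<close>.\<close>

lemma max_sep_attained:
  assumes "0 < e"
  obtains S where "S \<subseteq> X" "finite S" "separated f n e S" "card S = max_sep f X n e"
proof -
  have "0 < e / 8" using assms by simp
  then obtain C l where C: "finite C" "\<And>x. x \<in> X \<Longrightarrow> l x \<in> C" "\<And>x. x \<in> X \<Longrightarrow> dist (l x) x < e / 8"
    using finite_net_label by metis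
  have "card S \<le> card {W. W \<subseteq> {..<n} \<times> C \<and> card W \<le> n}" if "S \<subseteq> X" "separated f n e S" for S
  proof -
    have "card {k. k < n \<and> e / 2 < dist ((f ^^ k) t) ((f ^^ k) s)} \<le> n" for s t
      using card_mono[of "{..<n}" "{k. k < n \<and> e / 2 < dist ((f ^^ k) t) ((f ^^ k) s)}"] by auto
    then show ?thesis using card_separated_near[OF that(2,1) C, of _ n] by simp
  qed
  then have "{card S | S. S \<subseteq> X \<and> finite S \<and> separated f n e S} \<subseteq> {..card {W. W \<subseteq> {..<n} \<times> C \<and> card W \<le> n}}"
    by auto
  then have fin: "finite {card S | S. S \<subseteq> X \<and> finite S \<and> separated f n e S}"
    by (rule finite_subset) simp
  have "card {} \<in> {card S | S. S \<subseteq> X \<and> finite S \<and> separated f n e S}"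
    by (rule CollectI, rule exI[of _ "{}"]) (simp add: separated_def)
  then have ne: "{card S | S. S \<subseteq> X \<and> finite S \<and> separated f n e S} \<noteq> {}" by blast
  have "max_sep f X n e \<in> {card S | S. S \<subseteq> X \<and> finite S \<and> separated f n e S}"
    unfolding max_sep_def cSup_eq_Max[OF fin ne] by (rule Max_in[OF fin ne])
  then obtain S where "max_sep f X n e = card S" "S \<subseteq> X \<and> finite S \<and> separated f n e S"
    by (rule CollectE) blast
  then show ?thesis using that by metis
qed

text \<open>Take \<open>T\<close> maximal. Then every point of \<open>S\<close> is far from some
  point of \<open>T\<close> at no more than \<open>d\<close> times, and the points so attached to
  one member of \<open>T\<close> are few by \<open>card_separated_near\<close>.\<close>

lemma spread_subset:
  assumes sep: "separated f n e S" and S: "S \<subseteq> X" "finite S"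
    and C: "finite C" "\<And>x. x \<in> X \<Longrightarrow> l x \<in> C" "\<And>x. x \<in> X \<Longrightarrow> dist (l x) x < e / 8"
  obtains T where "T \<subseteq> S" "card S \<le> card T * card {W. W \<subseteq> {..<n} \<times> C \<and> card W \<le> d}"
    "\<And>s t. s \<in> T \<Longrightarrow> t \<in> T \<Longrightarrow> s \<noteq> t \<Longrightarrow> d < card {k. k < n \<and> e / 2 < dist ((f ^^ k) s) ((f ^^ k) t)}"
proof -
  define D where "D s t = card {k. k < n \<and> e / 2 < dist ((f ^^ k) s) ((f ^^ k) t)}" for s t
  have D_sym: "D s t = D t s" for s t by (simp add: D_def dist_commute)
  define \<T> where "\<T> = {T. T \<subseteq> S \<and> (\<forall>s\<in>T. \<forall>t\<in>T. s \<noteq> t \<longrightarrow> d < D s t)}"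
  have "finite \<T>" by (rule finite_subset[of _ "Pow S"]) (auto simp: \<T>_def S(2))
  moreover have "{} \<in> \<T>" by (simp add: \<T>_def)
  ultimately obtain T where T: "T \<in> \<T>" "\<And>T'. T' \<in> \<T> \<Longrightarrow> T \<subseteq> T' \<Longrightarrow> T = T'"
    using finite_has_maximal[of \<T>] by (metis empty_iff)
  have T_sub: "T \<subseteq> S" using T(1) by (simp add: \<T>_def)
  have cover: "S \<subseteq> (\<Union>t\<in>T. {s \<in> S. D t s \<le> d})"
  proof
    fix s assume s: "s \<in> S"
    have "\<exists>t\<in>T. D t s \<le> d"
    proof (rule ccontr)
      assume far: "\<not> ?thesis"
      then have "d < D t s" "d < D s t" if "t \<in> T" for t
        using that D_sym[of s t] by (auto simp: not_le)
      then have "insert s T \<in> \<T>"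
        using T(1) s unfolding \<T>_def by blast
      from T(2)[OF this] have "s \<in> T" by blast
      with far have "d < D s s" by (auto simp: not_le)
      \<comment> \<open>For \<open>0 \<le> e\<close> no time is counted; a negative \<open>e\<close>
        contradicts the label bound at \<open>s\<close>.\<close>
      moreover have "D s s \<le> d"
      proof (cases "0 \<le> e")
        case True
        then show ?thesis by (simp add: D_def)
      next
        case False
        then show ?thesis using C(3)[of s] s S(1) zero_le_dist[of "l s" s] by force
      qed
      ultimately show False by simp
    qed
    then show "s \<in> (\<Union>t\<in>T. {s \<in> S. D t s \<le> d})" using s by blast
  qed
  have fin: "finite T" using T_sub S(2) finite_subset by blast
  have "card S \<le> card (\<Union>t\<in>T. {s \<in> S. D t s \<le> d})"
    using cover fin S(2) by (intro card_mono) auto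
  also have "\<dots> \<le> (\<Sum>t\<in>T. card {s \<in> S. D t s \<le> d})" using fin by (rule card_UN_le)
  also have "\<dots> \<le> (\<Sum>t\<in>T. card {W. W \<subseteq> {..<n} \<times> C \<and> card W \<le> d})"
    unfolding D_def by (intro sum_mono card_separated_near[OF sep S(1) C])
  finally have "card S \<le> card T * card {W. W \<subseteq> {..<n} \<times> C \<and> card W \<le> d}" by simp
  with T_sub T(1) that[of T] show ?thesis by (auto simp: \<T>_def D_def)
qed

text \<open>Coordinates are pairs of a time and a net point. If \<open>s\<close> and
  \<open>t\<close> are more than \<open>e / 2\<close> apart at time \<open>k\<close>, the label of
  \<open>s\<close> is within \<open>e / 8\<close> of \<open>s\<close> and more than
  \<open>3 * e / 8\<close> from \<open>t\<close>. So a proportion \<open>\<alpha> / card C\<close>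
  of the coordinates separates them.\<close>

lemma shatters_spread:
  fixes \<alpha> :: real
  assumes T: "T \<subseteq> X" "finite T" and "0 < e" "0 < \<alpha>" "\<alpha> \<le> 1" and n: "0 < n" and "C \<noteq> {}"
    and C: "finite C" "\<And>x. x \<in> X \<Longrightarrow> l x \<in> C" "\<And>x. x \<in> X \<Longrightarrow> dist (l x) x < e / 8"
    and spread: "\<And>s t. s \<in> T \<Longrightarrow> t \<in> T \<Longrightarrow> s \<noteq> t \<Longrightarrow> \<alpha> * n \<le> card {k. k < n \<and> e / 2 < dist ((f ^^ k) s) ((f ^^ k) t)}"
    and large: "(2 * card C / \<alpha>) ^ j \<le> card T"
  shows "2 ^ j \<le> card {W. W \<subseteq> {..<n} \<times> C \<and>
    shatters (\<lambda>i x. dist (snd i) ((f ^^ fst i) x) \<le> e / 8) (\<lambda>i x. 2 * (e / 8) \<le> dist (snd i) ((f ^^ fst i) x)) X W}"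
    (is "_ \<le> card {W. W \<subseteq> _ \<and> shatters ?P ?Q X W}")
proof -
  have m: "0 < card C" using C(1) \<open>C \<noteq> {}\<close> by (simp add: card_gt_0_iff)
  have "2 ^ j \<le> card {W. W \<subseteq> {..<n} \<times> C \<and> shatters ?P ?Q T W}"
  proof (rule many_shattered_sets[where \<beta> = "\<alpha> / card C"])
    show "finite ({..<n} \<times> C)" using C(1) by simp
    show "{..<n} \<times> C \<noteq> {}" using n \<open>C \<noteq> {}\<close> by auto
    show "0 < \<alpha> / card C" using assms(4) m by simp
    show "\<alpha> / card C \<le> 1" using assms(5) m by (simp add: field_simps)
    show "\<not> ?Q i x" if "?P i x" for i x using that \<open>0 < e\<close> by simp
    show "finite T" by fact
    show "(2 / (\<alpha> / card C)) ^ j \<le> card T" using large by simp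
    fix s t assume st: "s \<in> T" "t \<in> T" "s \<noteq> t"
    let ?K = "{k. k < n \<and> e / 2 < dist ((f ^^ k) s) ((f ^^ k) t)}"
    have "(\<lambda>k. (k, l ((f ^^ k) s))) ` ?K \<subseteq> {i \<in> {..<n} \<times> C. ?P i s \<and> ?Q i t}"
    proof (rule image_subsetI)
      fix k assume k: "k \<in> ?K"
      have "(f ^^ k) s \<in> X" using st(1) T(1) by (intro funpow_in) auto
      note near = C(2,3)[OF this]
      moreover have "2 * (e / 8) \<le> dist (l ((f ^^ k) s)) ((f ^^ k) t)"
        using k near(2) \<open>0 < e\<close> dist_triangle3[of "(f ^^ k) s" "(f ^^ k) t" "l ((f ^^ k) s)"]
        by simp
      ultimately show "(k, l ((f ^^ k) s)) \<in> {i \<in> {..<n} \<times> C. ?P i s \<and> ?Q i t}"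
        using k by simp
    qed
    then have "card ((\<lambda>k. (k, l ((f ^^ k) s))) ` ?K) \<le> card {i \<in> {..<n} \<times> C. ?P i s \<and> ?Q i t}"
      using C(1) by (intro card_mono) auto
    moreover have "card ((\<lambda>k. (k, l ((f ^^ k) s))) ` ?K) = card ?K"
      by (rule card_image) (simp add: inj_on_def)
    moreover have "\<alpha> / card C * card ({..<n} \<times> C) = \<alpha> * n"
      using m by (simp add: card_cartesian_product)
    ultimately show "\<alpha> / card C * card ({..<n} \<times> C) \<le> card {i \<in> {..<n} \<times> C. ?P i s \<and> ?Q i t}"
      using spread[OF st] by linarith
  qed
  also have "\<dots> \<le> card {W. W \<subseteq> {..<n} \<times> C \<and> shatters ?P ?Q X W}"
    using C(1) shatters_mono_set[OF _ T(1)] by (intro card_mono) auto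
  finally show ?thesis .
qed

text \<open>Split \<open>W\<close> into columns, one per net point. Some column has at least average
  size, and shattering it means independence for its net point.\<close>

lemma independent_of_shattered:
  fixes \<delta> :: real
  assumes "finite C" "C \<noteq> {}" "W \<subseteq> {..<n} \<times> C" "\<delta> * n \<le> card W"
    and W: "shatters (\<lambda>i x. dist (snd i) ((f ^^ fst i) x) \<le> r) (\<lambda>i x. 2 * r \<le> dist (snd i) ((f ^^ fst i) x)) X W"
  obtains p F where "p \<in> C" "F \<subseteq> {..<n}" "\<delta> / card C * n \<le> card F" "independent f p r X F"
proof -
  have m: "0 < card C" using assms(1,2) by (simp add: card_gt_0_iff)
  define F where "F p = {k. (k, p) \<in> W}" for p
  have F: "F p \<subseteq> {..<n}" for p using assms(3) by (auto simp: F_def)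
  have "\<exists>p\<in>C. \<delta> / card C * n \<le> card (F p)"
  proof (rule ccontr)
    assume "\<not> ?thesis"
    then have less: "card (F p) < \<delta> / card C * n" if "p \<in> C" for p using that by force
    have "W \<subseteq> (\<Union>p\<in>C. F p \<times> {p})" using assms(3) by (auto simp: F_def)
    then have "card W \<le> card (\<Union>p\<in>C. F p \<times> {p})"
      using assms(1) finite_subset[OF F] by (intro card_mono) auto
    also have "\<dots> \<le> (\<Sum>p\<in>C. card (F p \<times> {p}))" using assms(1) by (rule card_UN_le)
    finally have "card W \<le> (\<Sum>p\<in>C. card (F p))" by (simp add: card_cartesian_product)
    then have "real (card W) \<le> (\<Sum>p\<in>C. real (card (F p)))" by (simp flip: of_nat_sum)
    also have "\<dots> < (\<Sum>p\<in>C. \<delta> / card C * n)"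
      using assms(1,2) less by (intro sum_strict_mono) auto
    also have "\<dots> = \<delta> * n" using m by simp
    finally show False using assms(4) by simp
  qed
  then obtain p where p: "p \<in> C" "\<delta> / card C * n \<le> card (F p)" by blast
  have "independent f p r X (F p)"
  proof (rule independentI)
    fix I assume I: "I \<subseteq> F p"
    then have "I \<times> {p} \<subseteq> W" by (auto simp: F_def)
    from shattersD[OF W this] obtain x where x: "x \<in> X"
      "\<And>i. i \<in> I \<times> {p} \<Longrightarrow> dist (snd i) ((f ^^ fst i) x) \<le> r"
      "\<And>i. i \<in> W - I \<times> {p} \<Longrightarrow> 2 * r \<le> dist (snd i) ((f ^^ fst i) x)" by blast
    show "\<exists>x\<in>X. (\<forall>j\<in>I. dist p ((f ^^ j) x) \<le> r) \<and> (\<forall>j\<in>F p - I. 2 * r \<le> dist p ((f ^^ j) x))"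
      using x(1) x(2)[of "(_, p)"] x(3)[of "(_, p)"] by (intro bexI[of _ x]) (auto simp: F_def)
  qed
  with p F show ?thesis using that by blast
qed

lemma independent_of_many_separated:
  assumes e: "0 < e" and c: "0 < c" and C: "finite C" "C \<noteq> {}"
    and l: "\<And>x. x \<in> X \<Longrightarrow> l x \<in> C" "\<And>x. x \<in> X \<Longrightarrow> dist (l x) x < e / 8"
  obtains \<delta> :: real and N where "0 < \<delta>" "\<And>n. N \<le> n \<Longrightarrow> exp (c * n) \<le> max_sep f X n e \<Longrightarrow>
    \<exists>p\<in>C. \<exists>F\<subseteq>{..<n}. \<delta> * n \<le> card F \<and> independent f p (e / 8) X F"
proof -
  define m where "m = card C"
  have m: "0 < m" using C by (simp add: m_def card_gt_0_iff)
  have "0 < c / 2" using c by simp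
  then obtain \<alpha> where \<alpha>: "0 < \<alpha>" "\<alpha> \<le> 1"
    "\<And>(A :: (nat \<times> 'a) set) n d. finite A \<Longrightarrow> card A \<le> n * m \<Longrightarrow> real d \<le> \<alpha> * n \<Longrightarrow>
       card {W. W \<subseteq> A \<and> card W \<le> d} \<le> exp (c / 2 * n)"
    by (rule card_small_subsets_subexponential[where m = m and 'i = "nat \<times> 'a"]) (rule that)
  \<comment> \<open>\<open>K\<close> is the base required by \<open>shatters_spread\<close>;
    \<open>a\<close> is chosen so that \<open>K ^ j\<close> is at most
    \<open>exp (c / 2 * n)\<close> whenever \<open>j \<le> a * n\<close>.\<close>
  define K where "K = 2 * m / \<alpha>"
  have K: "1 < K" using \<alpha>(1,2) m by (simp add: K_def field_simps)
  define a where "a = c / (2 * ln K)"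
  have a: "0 < a" using K c by (simp add: a_def)
  \<comment> \<open>For \<open>j > a * n - 1\<close> the number \<open>2 ^ j\<close> exceeds
    \<open>exp (2 * \<eta> * n) / 2\<close>. This beats \<open>exp (\<eta> * n)\<close> once
    \<open>\<eta> * n > ln 2\<close>, which \<open>N0\<close> ensures.\<close>
  define \<eta> where "\<eta> = a * ln 2 / 2"
  have \<eta>: "0 < \<eta>" using a by (simp add: \<eta>_def)
  then obtain \<delta> where \<delta>: "0 < \<delta>"
    "\<And>(A :: (nat \<times> 'a) set) n d. finite A \<Longrightarrow> card A \<le> n * m \<Longrightarrow> real d \<le> \<delta> * n \<Longrightarrow>
       card {W. W \<subseteq> A \<and> card W \<le> d} \<le> exp (\<eta> * n)"
    by (rule card_small_subsets_subexponential[where m = m and 'i = "nat \<times> 'a"]) (rule that)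
  obtain N0 :: nat where N0: "ln 2 < N0 * \<eta>" using reals_Archimedean3[OF \<eta>] by blast
  show thesis
  proof (rule that[of "\<delta> / card C" "Suc N0"])
    show "0 < \<delta> / card C" using \<delta>(1) m by (simp add: m_def)
    fix n assume n: "Suc N0 \<le> n" and many: "exp (c * n) \<le> max_sep f X n e"
    have cardC: "card ({..<n} \<times> C) \<le> n * m" by (simp add: m_def card_cartesian_product)
    have finC: "finite ({..<n} \<times> C)" using C(1) by simp
    obtain S where S: "S \<subseteq> X" "finite S" "separated f n e S" "card S = max_sep f X n e"
      using max_sep_attained[OF e] by metis
    define d where "d = nat \<lfloor>\<alpha> * n\<rfloor>"
    have d: "real d \<le> \<alpha> * n" "\<alpha> * n < real (Suc d)"
      using \<alpha>(1) by (auto simp: d_def of_nat_floor intro: le_less_trans) linarith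
    obtain T where T: "T \<subseteq> S" "card S \<le> card T * card {W. W \<subseteq> {..<n} \<times> C \<and> card W \<le> d}"
      "\<And>s t. s \<in> T \<Longrightarrow> t \<in> T \<Longrightarrow> s \<noteq> t \<Longrightarrow> d < card {k. k < n \<and> e / 2 < dist ((f ^^ k) s) ((f ^^ k) t)}"
      by (rule spread_subset[OF S(3,1,2) C(1) l, of d]) (assumption, assumption, rule that)
    define j where "j = nat \<lfloor>a * n\<rfloor>"
    have j: "real j \<le> a * n" "a * n < real j + 1"
      using a by (auto simp: j_def of_nat_floor)
    have "K ^ j = exp (j * ln K)" using K by (simp add: exp_of_nat_mult)
    also have "\<dots> \<le> exp (a * n * ln K)" using j(1) K by (simp add: mult_right_mono)
    also have "a * n * ln K = c / 2 * n" using K by (simp add: a_def)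
    finally have Kj: "K ^ j \<le> exp (c / 2 * n)" .
    \<comment> \<open>Thinning costs at most a factor \<open>exp (c / 2 * n)\<close>, so at least
      that many points remain in \<open>T\<close>.\<close>
    have "exp (c / 2 * n) * exp (c / 2 * n) = exp (c * n)"
      by (simp flip: exp_add)
    also have "\<dots> \<le> card S" using many S(4) by simp
    also have "\<dots> \<le> card T * real (card {W. W \<subseteq> {..<n} \<times> C \<and> card W \<le> d})"
      using T(2) by (simp flip: of_nat_mult)
    also have "\<dots> \<le> card T * exp (c / 2 * n)"
      using \<alpha>(3)[OF finC cardC d(1)] by (intro mult_left_mono) auto
    finally have "exp (c / 2 * n) \<le> card T" by simp
    with Kj have large: "(2 * card C / \<alpha>) ^ j \<le> card T" by (simp add: K_def m_def)
    have T': "T \<subseteq> X" "finite T" using T(1) S(1) finite_subset[OF T(1) S(2)] by auto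
    have spread: "\<alpha> * n \<le> card {k. k < n \<and> e / 2 < dist ((f ^^ k) s) ((f ^^ k) t)}"
      if "s \<in> T" "t \<in> T" "s \<noteq> t" for s t
      using T(3)[OF that] d(2) by linarith
    have "0 < n" using n by simp
    note shattered = shatters_spread[OF T' e \<alpha>(1,2) this C(2,1) l spread large]
    define d' where "d' = nat \<lfloor>\<delta> * n\<rfloor>"
    have d': "real d' \<le> \<delta> * n" "\<delta> * n < real (Suc d')"
      using \<delta>(1) by (auto simp: d'_def of_nat_floor) linarith
    have "card {W. W \<subseteq> {..<n} \<times> C \<and> card W \<le> d'} \<le> exp (\<eta> * n)"
      by (rule \<delta>(2)[OF finC cardC d'(1)])
    also have "\<dots> < 2 ^ j"
    proof -
      have "N0 * \<eta> \<le> n * \<eta>" using n \<eta> by (intro mult_right_mono) auto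
      with N0 have "\<eta> * n < 2 * (\<eta> * n) - ln 2" by (simp add: mult.commute)
      also have "2 * (\<eta> * n) - ln 2 = (a * n - 1) * ln 2" by (simp add: \<eta>_def algebra_simps)
      also have "\<dots> \<le> j * ln 2" using j(2) by (intro mult_right_mono) auto
      finally have "exp (\<eta> * n) < exp (j * ln 2)" by simp
      then show ?thesis by (simp add: exp_of_nat_mult)
    qed
    finally have "card {W. W \<subseteq> {..<n} \<times> C \<and> card W \<le> d'} < 2 ^ j" by simp
    with shattered have less: "card {W. W \<subseteq> {..<n} \<times> C \<and> card W \<le> d'} < card {W. W \<subseteq> {..<n} \<times> C \<and>
      shatters (\<lambda>i x. dist (snd i) ((f ^^ fst i) x) \<le> e / 8) (\<lambda>i x. 2 * (e / 8) \<le> dist (snd i) ((f ^^ fst i) x)) X W}"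
      by (rule less_le_trans[rotated])
    obtain W where W: "W \<subseteq> {..<n} \<times> C" "d' < card W"
      "shatters (\<lambda>i x. dist (snd i) ((f ^^ fst i) x) \<le> e / 8) (\<lambda>i x. 2 * (e / 8) \<le> dist (snd i) ((f ^^ fst i) x)) X W"
    proof (rule ccontr)
      assume "\<not> thesis"
      then have "{W. W \<subseteq> {..<n} \<times> C \<and>
        shatters (\<lambda>i x. dist (snd i) ((f ^^ fst i) x) \<le> e / 8) (\<lambda>i x. 2 * (e / 8) \<le> dist (snd i) ((f ^^ fst i) x)) X W}
        \<subseteq> {W. W \<subseteq> {..<n} \<times> C \<and> card W \<le> d'}" 
        using that not_le_imp_less by blast
      then have "card {W. W \<subseteq> {..<n} \<times> C \<and>
        shatters (\<lambda>i x. dist (snd i) ((f ^^ fst i) x) \<le> e / 8) (\<lambda>i x. 2 * (e / 8) \<le> dist (snd i) ((f ^^ fst i) x)) X W}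
        \<le> card {W. W \<subseteq> {..<n} \<times> C \<and> card W \<le> d'}" using finC by (intro card_mono) auto
      with less show False by simp
    qed
    have "\<delta> * n \<le> card W" using W(2) d'(2) by linarith
    from independent_of_shattered[OF C W(1) this W(3)] obtain p F where "p \<in> C" "F \<subseteq> {..<n}"
      "\<delta> / card C * n \<le> card F" "independent f p (e / 8) X F" by blast
    then show "\<exists>p\<in>C. \<exists>F\<subseteq>{..<n}. \<delta> / card C * n \<le> card F \<and> independent f p (e / 8) X F" by blast
  qed
qed

lemma positive_entropy_independence_density:
  assumes "0 < topological_entropy f X"
  obtains p r \<delta> where "0 < r" "0 < \<delta>" "independence_density f p r \<delta> X"
proof -
  from assms obtain e where e: "0 < e" "0 < limsup (\<lambda>n. ereal (ln (real (max_sep f X n e)) / real n))"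
    unfolding topological_entropy_def less_SUP_iff by auto
  then obtain c where "0 < ereal c" and c': "ereal c < limsup (\<lambda>n. ereal (ln (real (max_sep f X n e)) / real n))"
    using ereal_dense2[OF e(2)] by blast
  then have c: "0 < c" by simp
  have "\<exists>\<^sub>F n in sequentially. c < ln (real (max_sep f X n e)) / real n"
  proof (rule ccontr)
    assume "\<not> ?thesis"
    then have "\<forall>\<^sub>F n in sequentially. ereal (ln (real (max_sep f X n e)) / real n) \<le> c"
      by (simp add: not_frequently not_less)
    then have "limsup (\<lambda>n. ereal (ln (real (max_sep f X n e)) / real n)) \<le> c" by (rule Limsup_bounded)
    with c' show False by simp
  qed
  moreover have "exp (c * n) \<le> max_sep f X n e" if less: "c < ln (real (max_sep f X n e)) / real n" for n
  proof -
    \<comment> \<open>By the conventions \<open>x / 0 = 0\<close> and \<open>ln 0 = 0\<close>,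
      positivity of \<open>c\<close> excludes \<open>n = 0\<close> here and a zero count
      below.\<close>
    have n: "0 < n" using less c by (cases n) auto
    then have *: "c * n < ln (real (max_sep f X n e))" using less by (simp add: field_simps)
    have "0 \<le> c * n" using c by simp
    with * have "max_sep f X n e \<noteq> 0" by (intro notI) simp
    then have "exp (ln (real (max_sep f X n e))) = max_sep f X n e" by simp
    with * show ?thesis by (metis exp_less_cancel_iff less_imp_le)
  qed
  ultimately have freq: "\<exists>\<^sub>F n in sequentially. exp (c * n) \<le> max_sep f X n e"
    by (auto elim: frequently_elim1)
  have "0 < e / 8" using e(1) by simp
  then obtain C l where C: "finite C" "\<And>x. x \<in> X \<Longrightarrow> l x \<in> C" "\<And>x. x \<in> X \<Longrightarrow> dist (l x) x < e / 8"
    using finite_net_label by metis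
  have "C \<noteq> {}"
  proof
    assume "C = {}"
    then have "X = {}" using C(2) by blast
    have "max_sep f X n e = 0" for n
      using max_sep_attained[OF e(1), of n] \<open>X = {}\<close> by (metis card.empty subset_empty)
    moreover have "0 < exp (c * n)" for n :: nat by simp
    ultimately show False using frequently_ex[OF freq] by (simp add: not_le[symmetric])
  qed
  then obtain \<delta> :: real and N where \<delta>: "0 < \<delta>"
    "\<And>n. N \<le> n \<Longrightarrow> exp (c * n) \<le> max_sep f X n e \<Longrightarrow>
      \<exists>p\<in>C. \<exists>F\<subseteq>{..<n}. \<delta> * n \<le> card F \<and> independent f p (e / 8) X F"
    by (rule independent_of_many_separated[OF e(1) c C(1) _ C(2,3)]) (assumption, assumption, rule that)
  have "\<exists>\<^sub>F n in sequentially. \<exists>p\<in>C. \<exists>F\<subseteq>{..<n}. \<delta> * n \<le> card F \<and> independent f p (e / 8) X F"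
    using frequently_eventually_conj[OF freq eventually_ge_at_top[of N]] \<delta>(2)
    by (auto elim: frequently_elim1)
  \<comment> \<open>The finite net was fixed before \<open>n\<close>, so one of its points serves
    infinitely many \<open>n\<close>.\<close>
  from frequently_bex_finite[OF C(1) this] obtain p
    where "\<exists>\<^sub>F n in sequentially. \<exists>F\<subseteq>{..<n}. \<delta> * n \<le> card F \<and> independent f p (e / 8) X F"
    by blast
  then have "independence_density f p (e / 8) (\<delta> / 2) X"
    using \<delta>(1) by (intro independence_density_of_frequently) auto
  then show ?thesis using that[of "e / 8" "\<delta> / 2" p] e(1) \<delta>(1) by simp
qed

lemma topological_entropy_nonneg: "0 \<le> topological_entropy f X"
proof -
  have "0 \<le> limsup (\<lambda>n. ereal (ln (real (max_sep f X n 1)) / real n))"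
  proof (rule le_Limsup)
    \<comment> \<open>The case \<open>k = 0\<close> rests on the value
      \<open>ln 0 = 0\<close>.\<close>
    have "0 \<le> ln (real k)" for k by (cases k) auto
    then show "\<forall>\<^sub>F n in sequentially. 0 \<le> ereal (ln (real (max_sep f X n 1)) / real n)" by simp
  qed simp
  also have "\<dots> \<le> topological_entropy f X"
    unfolding topological_entropy_def by (rule SUP_upper) simp
  finally show ?thesis .
qed

end

section \<open>Itineraries that produce uncountably many stable classes\<close>

section \<open>Stable classes\<close>

context compact_dynamics
begin

text \<open>If \<open>a\<close> lies in \<open>A\<close> but not in \<open>B\<close>, the orbits of
  \<open>x A\<close> and \<open>x B\<close> are at least \<open>r\<close> apart at infinitely many
  times, so the classes differ. This embeds the power set of the naturals into the stable
  classes.\<close>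

lemma uncountable_stable_classes:
  assumes r: "0 < r" and J: "independent f p r X J" "infinite J"
  shows "uncountable {stable_class f X x | x. x \<in> X}"
proof
  assume count: "countable {stable_class f X x | x. x \<in> X}"
  obtain e :: "nat \<Rightarrow> nat" where e: "inj e" "range e \<subseteq> J"
    using infinite_countable_subset[OF J(2)] by blast
  \<comment> \<open>\<open>J\<close> is split into infinitely many infinite pieces, indexed by \<open>a\<close>, so that distinct \<open>A\<close>
     prescribe itineraries which differ on a whole piece.\<close>
  define I where "I A = (\<lambda>(a, b). e (prod_encode (a, b))) ` (A \<times> UNIV)" for A
  have "\<exists>x\<in>X. (\<forall>j\<in>I A. dist p ((f ^^ j) x) \<le> r) \<and> (\<forall>j\<in>J - I A. 2 * r \<le> dist p ((f ^^ j) x))" for A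
  proof -
    have "I A \<subseteq> J" using e(2) by (auto simp: I_def)
    from independentD[OF J(1) this] show ?thesis by metis
  qed
  then obtain x where x: "\<And>A. x A \<in> X" "\<And>A j. j \<in> I A \<Longrightarrow> dist p ((f ^^ j) (x A)) \<le> r"
    "\<And>A j. j \<in> J \<Longrightarrow> j \<notin> I A \<Longrightarrow> 2 * r \<le> dist p ((f ^^ j) (x A))"
    by (metis DiffI)
  have differ: "stable_class f X (x A) \<noteq> stable_class f X (x B)" if a: "a \<in> A" "a \<notin> B" for a A B
  proof
    assume "stable_class f X (x A) = stable_class f X (x B)"
    moreover have "x A \<in> stable_class f X (x A)" using x(1) by (simp add: stable_class_def)
    ultimately have "(\<lambda>n. dist ((f ^^ n) (x A)) ((f ^^ n) (x B))) \<longlonglongrightarrow> 0"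
      by (simp add: stable_class_def)
    from order_tendstoD(2)[OF this r] obtain N
      where N: "\<And>n. n \<ge> N \<Longrightarrow> dist ((f ^^ n) (x A)) ((f ^^ n) (x B)) < r"
      unfolding eventually_sequentially by blast
    have "inj (\<lambda>b. e (prod_encode (a, b)))"
      by (rule injI) (simp add: inj_eq[OF e(1)])
    then have "infinite (range (\<lambda>b. e (prod_encode (a, b))))" by (rule range_inj_infinite)
    then obtain b where b: "e (prod_encode (a, b)) \<ge> N"
      unfolding infinite_nat_iff_unbounded_le by blast
    let ?j = "e (prod_encode (a, b))"
    have "dist p ((f ^^ ?j) (x A)) \<le> r"
      using a(1) by (intro x(2)) (auto simp: I_def)
    moreover have "2 * r \<le> dist p ((f ^^ ?j) (x B))"
      using a(2) e(2) by (intro x(3)) (auto simp: I_def inj_eq[OF e(1)])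
    moreover have "dist p ((f ^^ ?j) (x B)) \<le> dist p ((f ^^ ?j) (x A)) + dist ((f ^^ ?j) (x A)) ((f ^^ ?j) (x B))"
      by (rule dist_triangle)
    ultimately show False using N[OF b] by linarith
  qed
  have "inj (\<lambda>A. stable_class f X (x A))"
  proof (rule injI, rule ccontr)
    fix A B assume eq: "stable_class f X (x A) = stable_class f X (x B)" and "A \<noteq> B"
    then obtain a where "a \<in> A \<and> a \<notin> B \<or> a \<in> B \<and> a \<notin> A" by blast
    then show False using differ[of a A B] differ[of a B A] eq by auto
  qed
  moreover have "countable (range (\<lambda>A. stable_class f X (x A)))"
    by (rule countable_subset[OF _ count]) (use x(1) in blast)
  ultimately have "countable (UNIV :: nat set set)"
    by (rule countable_image_inj_on[rotated])
  from range_from_nat_into[OF UNIV_not_empty this]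
  have "range (from_nat_into (UNIV :: nat set set)) = Pow UNIV" by simp
  then show False using Cantors_theorem[of "UNIV :: nat set"] by blast
qed

end

section \<open>Omega-limit sets, rigidity and minimal subsystems\<close>

section \<open>Recurrence and Lyapunov stability\<close>

lemma mem_omega_limit_iff:
  "y \<in> omega_limit f x \<longleftrightarrow> (\<forall>e>0. \<forall>N. \<exists>k\<ge>N. dist ((f ^^ k) x) y < e)"
proof
  assume "y \<in> omega_limit f x"
  then obtain r where r: "strict_mono r" "(\<lambda>k. (f ^^ r k) x) \<longlonglongrightarrow> y"
    unfolding omega_limit_def by blast
  show "\<forall>e>0. \<forall>N. \<exists>k\<ge>N. dist ((f ^^ k) x) y < e"
  proof (intro allI impI)
    fix e :: real and N :: nat assume "0 < e"
    with r(2) obtain K where K: "\<And>k. k \<ge> K \<Longrightarrow> dist ((f ^^ r k) x) y < e"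
      unfolding lim_sequentially by blast
    have "max K N \<le> r (max K N)" using r(1) by (rule strict_mono_imp_increasing)
    then show "\<exists>k\<ge>N. dist ((f ^^ k) x) y < e"
      using K[of "max K N"] by (intro exI[of _ "r (max K N)"]) auto
  qed
next
  assume close: "\<forall>e>0. \<forall>N. \<exists>k\<ge>N. dist ((f ^^ k) x) y < e"
  have "\<exists>r. \<forall>n. dist ((f ^^ r n) x) y < 1 / Suc n \<and> r n < r (Suc n)"
  proof (rule dependent_nat_choice)
    show "\<exists>k. dist ((f ^^ k) x) y < 1 / Suc 0"
      using close[rule_format, of 1 0] by auto
    fix k n
    have "0 < 1 / real (Suc (Suc n))" by simp
    with close obtain k' where "k' \<ge> Suc k" "dist ((f ^^ k') x) y < 1 / Suc (Suc n)" by blast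
    then show "\<exists>k'. dist ((f ^^ k') x) y < 1 / Suc (Suc n) \<and> k < k'"
      by (intro exI[of _ k']) simp
  qed
  then obtain r where r: "\<And>n. dist ((f ^^ r n) x) y < 1 / Suc n" "\<And>n. r n < r (Suc n)" by blast
  have "(\<lambda>n. dist ((f ^^ r n) x) y) \<longlonglongrightarrow> 0"
  proof (rule tendsto_sandwich[of "\<lambda>_. 0"])
    show "\<forall>\<^sub>F n in sequentially. dist ((f ^^ r n) x) y \<le> inverse (real (Suc n))"
      using r(1) by (simp add: inverse_eq_divide less_imp_le)
    show "(\<lambda>n. inverse (real (Suc n))) \<longlonglongrightarrow> 0" by (rule LIMSEQ_inverse_real_of_nat)
  qed (auto intro: tendsto_const)
  then have "(\<lambda>n. (f ^^ r n) x) \<longlonglongrightarrow> y" using tendsto_dist_iff by blast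
  moreover have "strict_mono r" using r(2) by (simp add: strict_mono_Suc_iff)
  ultimately show "y \<in> omega_limit f x" unfolding omega_limit_def by blast
qed

lemma closed_omega_limit: "closed (omega_limit f x)"
proof -
  have "y \<in> omega_limit f x" if y: "y \<in> closure (omega_limit f x)" for y
    unfolding mem_omega_limit_iff
  proof (intro allI impI)
    fix e :: real and N :: nat assume "0 < e"
    then have e: "0 < e / 2" by simp
    with y obtain z where z: "z \<in> omega_limit f x" "dist z y < e / 2"
      unfolding closure_approachable by blast
    then obtain k where "k \<ge> N" "dist ((f ^^ k) x) z < e / 2"
      using e unfolding mem_omega_limit_iff by blast
    moreover have "dist ((f ^^ k) x) y \<le> dist ((f ^^ k) x) z + dist z y" by (rule dist_triangle)
    ultimately show "\<exists>k\<ge>N. dist ((f ^^ k) x) y < e" using z(2) by (intro exI[of _ k]) simp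
  qed
  then show ?thesis
    using closure_subset closure_eq by (metis subsetI subset_antisym)
qed

context compact_dynamics
begin

lemma omega_limit_subset:
  assumes "x \<in> X"
  shows "omega_limit f x \<subseteq> X"
proof
  fix y assume "y \<in> omega_limit f x"
  then obtain r where "(\<lambda>k. (f ^^ r k) x) \<longlonglongrightarrow> y" unfolding omega_limit_def by blast
  moreover have "\<And>k. (f ^^ r k) x \<in> X" using assms by (rule funpow_in)
  ultimately show "y \<in> X"
    using closed_sequentially[OF compact_imp_closed[OF compact], of "\<lambda>k. (f ^^ r k) x"] by blast
qed

lemma omega_limit_invariant:
  assumes "x \<in> X"
  shows "f ` omega_limit f x \<subseteq> omega_limit f x"
proof (rule image_subsetI)
  fix y assume y: "y \<in> omega_limit f x"
  then obtain r where r: "strict_mono r" "(\<lambda>k. (f ^^ r k) x) \<longlonglongrightarrow> y" unfolding omega_limit_def by blast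
  have "(\<lambda>k. (f ^^ 1) ((f ^^ r k) x)) \<longlonglongrightarrow> (f ^^ 1) y"
    using r(2) y omega_limit_subset[OF assms] by (intro tendsto_funpow funpow_in assms) auto
  then have "(\<lambda>k. (f ^^ Suc (r k)) x) \<longlonglongrightarrow> f y" by simp
  moreover have "strict_mono (\<lambda>k. Suc (r k))" using r(1) by (simp add: strict_mono_def)
  ultimately show "f y \<in> omega_limit f x" unfolding omega_limit_def by blast
qed

text \<open>Lyapunov stability compares only recurrent points, so it applies to \<open>x\<close> and
  a return \<open>(f ^^ k) x\<close> only if the latter is recurrent too.\<close>

lemma recurrent_set_funpow:
  assumes "x \<in> recurrent_set f X"
  shows "(f ^^ n) x \<in> recurrent_set f X"
proof -
  have x: "x \<in> X" "x \<in> omega_limit f x" using assms by (auto simp: recurrent_set_def)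
  then obtain r where r: "strict_mono r" "(\<lambda>k. (f ^^ r k) x) \<longlonglongrightarrow> x" unfolding omega_limit_def by blast
  have "(\<lambda>k. (f ^^ n) ((f ^^ r k) x)) \<longlonglongrightarrow> (f ^^ n) x"
    using r(2) x by (intro tendsto_funpow funpow_in) auto
  moreover have "(f ^^ n) ((f ^^ r k) x) = (f ^^ r k) ((f ^^ n) x)" for k
    by (metis add.commute comp_apply funpow_add)
  ultimately have "(f ^^ n) x \<in> omega_limit f ((f ^^ n) x)"
    using r(1) unfolding omega_limit_def by auto
  then show ?thesis using x(1) by (simp add: recurrent_set_def funpow_in)
qed

end

text \<open>If windows of density \<open>\<delta>\<close> stopped occurring, tiling the later times
  by windows would push the density of \<open>J\<close> below \<open>\<delta>\<close>. Since a
  window has finitely many possible traces, one dense trace recurs.\<close>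

lemma recurring_window:
  fixes J :: "nat set" and \<delta> :: real
  assumes "0 \<le> \<delta>" and J: "\<And>k. \<delta> * k \<le> card (J \<inter> {..<k})"
  obtains F where "F \<subseteq> {..<n}" "\<delta> * n \<le> card F" "infinite {m. {j. j < n \<and> m + j \<in> J} = F}"
proof -
  define W where "W m = {j. j < n \<and> m + j \<in> J}" for m
  have "infinite {m. \<delta> * n \<le> card (W m)}"
  proof
    assume "finite {m. \<delta> * n \<le> card (W m)}"
    then obtain M where M: "\<And>m. \<delta> * n \<le> card (W m) \<Longrightarrow> m < M"
      unfolding finite_nat_set_iff_bounded by blast
    \<comment> \<open>Cardinalities are integers, so those below \<open>\<delta> * n\<close> are at
      most \<open>q\<close>. Each block then falls short by the fixed positive amount
      \<open>\<delta> * n - q\<close>, and these deficits add up.\<close>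
    define q where "q = real_of_int (\<lceil>\<delta> * n\<rceil> - 1)"
    have q: "q < \<delta> * n" unfolding q_def by linarith
    have W: "card (W m) \<le> q" if "m \<ge> M" for m
    proof -
      have "real (card (W m)) < \<delta> * n" using M[of m] that by force
      then have "int (card (W m)) < \<lceil>\<delta> * n\<rceil>" by (simp add: less_ceiling_iff)
      then show ?thesis unfolding q_def by linarith
    qed
    have bound: "card (J \<inter> {..<M + t * n}) \<le> M + t * q" for t
    proof (induction t)
      case 0
      show ?case using card_mono[of "{..<M}" "J \<inter> {..<M}"] by simp
    next
      case (Suc t)
      have "J \<inter> {..<M + Suc t * n} \<subseteq> (J \<inter> {..<M + t * n}) \<union> (\<lambda>j. M + t * n + j) ` W (M + t * n)"
      proof
        fix j assume j: "j \<in> J \<inter> {..<M + Suc t * n}"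
        show "j \<in> (J \<inter> {..<M + t * n}) \<union> (\<lambda>j. M + t * n + j) ` W (M + t * n)"
        proof (cases "j < M + t * n")
          case False
          then show ?thesis using j
            by (intro UnI2 image_eqI[of _ _ "j - (M + t * n)"]) (auto simp: W_def)
        qed (use j in auto)
      qed
      then have "card (J \<inter> {..<M + Suc t * n})
          \<le> card ((J \<inter> {..<M + t * n}) \<union> (\<lambda>j. M + t * n + j) ` W (M + t * n))"
        by (intro card_mono) (auto simp: W_def)
      also have "\<dots> \<le> card (J \<inter> {..<M + t * n}) + card ((\<lambda>j. M + t * n + j) ` W (M + t * n))"
        by (rule card_Un_le)
      also have "\<dots> \<le> card (J \<inter> {..<M + t * n}) + card (W (M + t * n))"
        by (intro add_left_mono card_image_le) (auto simp: W_def)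
      finally have "real (card (J \<inter> {..<M + Suc t * n})) \<le> M + t * q + q"
        using Suc.IH W[of "M + t * n"] by linarith
      then show ?case by (simp add: algebra_simps)
    qed
    obtain t :: nat where t: "M < t * (\<delta> * n - q)"
      using reals_Archimedean3[of "\<delta> * n - q"] q by auto
    have "\<delta> * (M + t * n) \<le> M + t * q"
      using J[of "M + t * n"] bound[of t] by simp
    moreover have "0 \<le> \<delta> * M" using assms(1) by simp
    ultimately show False using t by (simp add: algebra_simps)
  qed
  moreover have "finite (W ` {m. \<delta> * n \<le> card (W m)})"
    by (rule finite_subset[of _ "Pow {..<n}"]) (auto simp: W_def)
  ultimately obtain m where m: "\<delta> * n \<le> card (W m)"
    "infinite {m' \<in> {m. \<delta> * n \<le> card (W m)}. W m' = W m}"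
    using pigeonhole_infinite by blast
  have "infinite {m'. W m' = W m}"
    using m(2) by (rule contrapos_nn) (auto elim: rev_finite_subset)
  with m(1) that[of "W m"] show ?thesis by (auto simp: W_def)
qed

context compact_dynamics
begin

text \<open>One orbit is made to show every pattern on every recurring window infinitely often;
  limits of its positions at the starts of such windows realize the patterns inside the omega-limit
  set.\<close>

lemma independence_density_omega_limit:
  fixes \<delta> :: real
  assumes "0 \<le> \<delta>" and ind: "independent f p r X J" and J: "\<And>k. \<delta> * k \<le> card (J \<inter> {..<k})"
  obtains x where "x \<in> X" "independence_density f p r \<delta> (omega_limit f x)"
proof -
  have "\<exists>F\<subseteq>{..<n}. \<delta> * n \<le> card F \<and> infinite {m. {j. j < n \<and> m + j \<in> J} = F}" for n
    using recurring_window[OF assms(1) J, of n] by blast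
  then have "\<exists>F. \<forall>n. F n \<subseteq> {..<n} \<and> \<delta> * n \<le> card (F n) \<and>
      infinite {m. {j. j < n \<and> m + j \<in> J} = F n}"
    by (intro choice allI) blast
  then obtain F where F_all: "\<forall>n. F n \<subseteq> {..<n} \<and> \<delta> * n \<le> card (F n) \<and>
      infinite {m. {j. j < n \<and> m + j \<in> J} = F n}" ..
  have F: "F n \<subseteq> {..<n}" "\<delta> * n \<le> card (F n)" "infinite {m. {j. j < n \<and> m + j \<in> J} = F n}" for n
    using F_all[THEN spec, of n] by simp_all
  \<comment> \<open>The request of index \<open>k\<close> is to show the pattern \<open>G k\<close> on the window \<open>F (len k)\<close>. Every
     request occurs for infinitely many \<open>k\<close>, and the windows are placed disjointly at \<open>m k\<close>.\<close>
  define len where "len k = fst (prod_decode (fst (prod_decode k)))" for k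
  define G where "G k = set_decode (snd (prod_decode (fst (prod_decode k)))) \<inter> F (len k)" for k
  have "\<exists>m. \<forall>k. (k \<le> m k \<and> {j. j < len k \<and> m k + j \<in> J} = F (len k)) \<and> m k + len k \<le> m (Suc k)"
  proof (rule dependent_nat_choice)
    show "\<exists>m\<ge>0. {j. j < len 0 \<and> m + j \<in> J} = F (len 0)"
      using F(3)[of "len 0"] not_finite_existsD by auto
    fix m k
    from F(3)[of "len (Suc k)"] obtain m' where "m' \<ge> max (Suc k) (m + len k)"
      "{j. j < len (Suc k) \<and> m' + j \<in> J} = F (len (Suc k))"
      unfolding infinite_nat_iff_unbounded_le by blast
    then show "\<exists>m'. (Suc k \<le> m' \<and> {j. j < len (Suc k) \<and> m' + j \<in> J} = F (len (Suc k))) \<and> m + len k \<le> m'"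
      by (intro exI[of _ m']) auto
  qed
  then obtain m where m: "\<And>k. k \<le> m k" "\<And>k. {j. j < len k \<and> m k + j \<in> J} = F (len k)"
    "\<And>k. m k + len k \<le> m (Suc k)" by blast
  have "incseq m" using m(3) by (intro incseq_SucI) (meson add_leD1)
  then have apart: "m k + len k \<le> m l" if "k < l" for k l
    using m(3)[of k] that by (meson Suc_leI incseqD le_trans)
  have FJ: "m k + j \<in> J" if "j \<in> F (len k)" for k j
    using m(2)[of k] that by blast
  define I where "I = (\<Union>k. (\<lambda>j. m k + j) ` G k)"
  have "I \<subseteq> J" using FJ by (auto simp: I_def G_def)
  from independentD[OF ind this] obtain x where x: "x \<in> X"
    "\<And>j. j \<in> I \<Longrightarrow> dist p ((f ^^ j) x) \<le> r" "\<And>j. j \<in> J - I \<Longrightarrow> 2 * r \<le> dist p ((f ^^ j) x)"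
    by blast
  \<comment> \<open>Windows are disjoint, so no other request can impose a near demand at this
    time.\<close>
  have notI: "m k + j \<notin> I" if "j \<in> F (len k)" "j \<notin> G k" for k j
  proof
    assume "m k + j \<in> I"
    then obtain l j' where l: "j' \<in> G l" "m k + j = m l + j'" by (auto simp: I_def)
    have "j' < len l" "j < len k" using l(1) that(1) F(1) by (auto simp: G_def)
    then have "k = l" using l(2) apart[of k l] apart[of l k] by (cases k l rule: linorder_cases) auto
    then show False using l that by simp
  qed
  have "independent f p r (omega_limit f x) (F n)" for n
  proof (rule independentI)
    fix H assume H: "H \<subseteq> F n"
    then have finH: "finite H" using finite_subset[OF order_trans[OF H F(1)]] by simp
    define k where "k i = prod_encode (prod_encode (n, set_encode H), i)" for i
    have k: "len (k i) = n" "G (k i) = H" "i \<le> k i" for i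
      using H finH by (auto simp: len_def G_def k_def le_prod_encode_2)
    define u where "u i = (f ^^ m (k i)) x" for i
    have shift: "(f ^^ j) (u i) = (f ^^ (m (k i) + j)) x" for i j
      by (simp add: u_def add.commute[of "m (k i)"] funpow_add)
    have u: "u i \<in> pattern p r H (F n)" for i
    proof -
      have "dist p ((f ^^ j) (u i)) \<le> r" if "j \<in> H" for j
        unfolding shift using that k(2)[of i] by (intro x(2)) (auto simp: I_def)
      moreover have "2 * r \<le> dist p ((f ^^ j) (u i))" if "j \<in> F n - H" for j
        unfolding shift using that FJ[of j "k i"] notI[of j "k i"] by (intro x(3)) (auto simp: k)
      ultimately show ?thesis using funpow_in[OF x(1)] by (simp add: pattern_def u_def)
    qed
    have "compact (pattern p r H (F n))"
      using compact_Int_closed[OF compact closed_pattern, of p r H "F n"]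
      by (simp add: pattern_def Int_def conj_ac)
    with u obtain y s where y: "y \<in> pattern p r H (F n)" and s: "strict_mono s" "(u \<circ> s) \<longlonglongrightarrow> y"
      unfolding compact_def by blast
    have "y \<in> omega_limit f x"
      unfolding mem_omega_limit_iff
    proof (intro allI impI)
      fix e :: real and N :: nat assume "0 < e"
      with s(2) obtain K where K: "\<And>i. i \<ge> K \<Longrightarrow> dist (u (s i)) y < e"
        unfolding lim_sequentially comp_def by blast
      let ?i = "max K N"
      have "?i \<le> s ?i" using s(1) by (rule strict_mono_imp_increasing)
      also have "\<dots> \<le> k (s ?i)" by (rule k)
      also have "\<dots> \<le> m (k (s ?i))" by (rule m)
      finally show "\<exists>l\<ge>N. dist ((f ^^ l) x) y < e"
        using K[of ?i] by (intro exI[of _ "m (k (s ?i))"]) (simp add: u_def)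
    qed
    then show "\<exists>y\<in>omega_limit f x. (\<forall>j\<in>H. dist p ((f ^^ j) y) \<le> r) \<and> (\<forall>j\<in>F n - H. 2 * r \<le> dist p ((f ^^ j) y))"
      using y by (auto simp: pattern_def)
  qed
  with F(1,2) have "independence_density f p r \<delta> (omega_limit f x)"
    unfolding independence_density_def by blast
  with x(1) show ?thesis by (rule that)
qed

text \<open>With \<open>(f ^^ k)\<close> within \<open>r / (2 * q)\<close> of the identity, the
  first \<open>q\<close> multiples of \<open>k\<close> give disjoint translates of \<open>F\<close>.
  They lie in an interval shorter than \<open>2 * n\<close>, too short for
  \<open>q > 2 / \<delta>\<close> sets of size \<open>\<delta> * n\<close>.\<close>

lemma rigid_not_independence_density:
  fixes \<delta> :: real
  assumes r: "0 < r" and \<delta>: "0 < \<delta>"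
    and rigid: "\<And>e. 0 < e \<Longrightarrow> \<exists>k>0. \<forall>z\<in>X. dist ((f ^^ k) z) z \<le> e"
  shows "\<not> independence_density f p r \<delta> X"
proof
  assume dens: "independence_density f p r \<delta> X"
  obtain q :: nat where q: "2 < q * \<delta>"
    using reals_Archimedean3[OF \<delta>] by blast
  then have "q \<noteq> 0" by (intro notI) simp
  then have "0 < r / (2 * q)" using r by simp
  from rigid[OF this] obtain k where k: "0 < k" "\<And>z. z \<in> X \<Longrightarrow> dist ((f ^^ k) z) z \<le> r / (2 * q)"
    by blast
  have multiple: "dist ((f ^^ (i * k)) z) z \<le> i * (r / (2 * q))" if "z \<in> X" for i z
  proof (induction i)
    case 0
    show ?case by simp
  next
    case (Suc i)
    have "dist ((f ^^ (Suc i * k)) z) z \<le> dist ((f ^^ k) ((f ^^ (i * k)) z)) ((f ^^ (i * k)) z) + dist ((f ^^ (i * k)) z) z"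
      using dist_triangle[of "(f ^^ (Suc i * k)) z" z "(f ^^ (i * k)) z"] by (simp add: funpow_add)
    also have "\<dots> \<le> r / (2 * q) + i * (r / (2 * q))"
      using Suc k(2) funpow_in[OF that] by (intro add_mono) auto
    also have "\<dots> = Suc i * (r / (2 * q))" by (simp add: add_divide_distrib distrib_right)
    finally show ?case .
  qed
  \<comment> \<open>This makes \<open>q * k < n\<close>, so that the translates lie below
    \<open>n + q * k < 2 * n\<close>.\<close>
  define n where "n = q * k + 1"
  from dens obtain F where F: "F \<subseteq> {..<n}" "\<delta> * n \<le> card F" "independent f p r X F"
    unfolding independence_density_def by blast
  \<comment> \<open>Demand that only time \<open>b\<close> be near. A further \<open>i * k\<close>
    steps move the point by at most \<open>r / 2\<close>, leaving it within \<open>3 * r / 2\<close>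
    of \<open>p\<close>, hence not far.\<close>
  have no_diff: "b + i * k \<notin> F" if "b \<in> F" "0 < i" "i < q" for b i
  proof
    assume a: "b + i * k \<in> F"
    have "{b} \<subseteq> F" using that by simp
    from independentD[OF F(3) this] obtain x where x: "x \<in> X" "\<And>j. j \<in> {b} \<Longrightarrow> dist p ((f ^^ j) x) \<le> r"
      "\<And>j. j \<in> F - {b} \<Longrightarrow> 2 * r \<le> dist p ((f ^^ j) x)" by blast
    have "2 * r \<le> dist p ((f ^^ (b + i * k)) x)" using a that k(1) by (intro x(3)) auto
    also have "(f ^^ (b + i * k)) x = (f ^^ (i * k)) ((f ^^ b) x)"
      by (simp add: add.commute[of b] funpow_add)
    also have "dist p \<dots> \<le> dist p ((f ^^ b) x) + dist ((f ^^ (i * k)) ((f ^^ b) x)) ((f ^^ b) x)"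
      by (metis dist_commute dist_triangle)
    also have "\<dots> \<le> r + i * (r / (2 * q))"
      using x(2)[of b] multiple[OF funpow_in[OF x(1)]] by (intro add_mono) auto
    also have "i * (r / (2 * q)) \<le> q * (r / (2 * q))"
      using that r by (intro mult_right_mono) auto
    also have "q * (r / (2 * q)) = r / 2" using \<open>q \<noteq> 0\<close> by simp
    finally show False using r by simp
  qed
  have fin: "finite F" using F(1) finite_subset by blast
  have inj: "inj_on (\<lambda>(i, a). a + i * k) ({..<q} \<times> F)"
  proof -
    have "i = i'" if "a \<in> F" "a' \<in> F" "i < q" "i' < q" "a + i * k = a' + i' * k" for a a' i i'
    proof (cases i i' rule: linorder_cases)
      case less
      have "a = a' + (i' - i) * k" using that(5) less by (simp add: diff_mult_distrib)
      then show ?thesis using no_diff[of a' "i' - i"] that less by simp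
    next
      case greater
      have "a' = a + (i - i') * k" using that(5) greater by (simp add: diff_mult_distrib)
      then show ?thesis using no_diff[of a "i - i'"] that greater by simp
    qed
    then show ?thesis by (fastforce simp: inj_on_def)
  qed
  have "q * card F = card ((\<lambda>(i, a). a + i * k) ` ({..<q} \<times> F))"
    using inj by (simp add: card_image card_cartesian_product)
  also have "\<dots> \<le> card {..<n + q * k}"
  proof (rule card_mono)
    show "(\<lambda>(i, a). a + i * k) ` ({..<q} \<times> F) \<subseteq> {..<n + q * k}"
      using F(1) by (auto intro!: add_less_le_mono mult_le_mono1)
  qed simp
  also have "\<dots> < 2 * n" by (simp add: n_def)
  finally have *: "real (q * card F) < 2 * n" by linarith
  have "2 * real n \<le> q * \<delta> * n" using q by (intro mult_right_mono) auto
  also have "\<dots> = q * (\<delta> * n)" by simp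
  also have "\<dots> \<le> q * real (card F)" using F(2) by (intro mult_left_mono) auto
  finally show False using * by simp
qed

definition dense_subsystem :: "'a \<Rightarrow> real \<Rightarrow> real \<Rightarrow> 'a set \<Rightarrow> bool" where
  "dense_subsystem p r \<delta> Z \<longleftrightarrow> closed Z \<and> Z \<subseteq> X \<and> f ` Z \<subseteq> Z \<and> independence_density f p r \<delta> Z"

text \<open>For each \<open>n\<close> one \<open>F\<close> works for the whole chain: otherwise the
  smallest of finitely many counterexamples would admit no \<open>F\<close>. Compactness then
  realizes each demand in the intersection.\<close>

lemma dense_subsystem_Inter:
  assumes ne: "\<Z> \<noteq> {}" and good: "\<And>Z. Z \<in> \<Z> \<Longrightarrow> dense_subsystem p r \<delta> Z"
    and chain: "subset.chain UNIV \<Z>"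
  shows "dense_subsystem p r \<delta> (\<Inter>\<Z>)"
proof -
  have fin_chain: "\<Inter>\<Y> \<in> \<Z>" if "finite \<Y>" "\<Y> \<noteq> {}" "\<Y> \<subseteq> \<Z>" for \<Y>
    using Inter_in_chain[OF that(1,2)] chain that(3) by (metis subset_chain_def subset_iff subset_UNIV)
  have "\<exists>F\<subseteq>{..<n}. \<delta> * n \<le> card F \<and> independent f p r (\<Inter>\<Z>) F" for n
  proof -
    define \<Phi> where "\<Phi> = {F. F \<subseteq> {..<n} \<and> \<delta> * n \<le> card F}"
    have fin: "finite \<Phi>" by (rule finite_subset[of _ "Pow {..<n}"]) (auto simp: \<Phi>_def)
    have ex: "\<exists>F\<in>\<Phi>. independent f p r Z F" if "Z \<in> \<Z>" for Z
      using good[OF that] unfolding dense_subsystem_def independence_density_def \<Phi>_def by blast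
    have "\<exists>F\<in>\<Phi>. \<forall>Z\<in>\<Z>. independent f p r Z F"
    proof (rule ccontr)
      assume "\<not> ?thesis"
      then obtain B where B: "\<And>F. F \<in> \<Phi> \<Longrightarrow> B F \<in> \<Z> \<and> \<not> independent f p r (B F) F" by metis
      have "\<Phi> \<noteq> {}" using ex ne by blast
      with fin B have "\<Inter>(B ` \<Phi>) \<in> \<Z>" by (intro fin_chain) auto
      from ex[OF this] obtain F where "F \<in> \<Phi>" "independent f p r (\<Inter>(B ` \<Phi>)) F" by blast
      with B[of F] show False using independent_mono[of f p r "\<Inter>(B ` \<Phi>)" F "B F"] by blast
    qed
    then obtain F where F: "F \<in> \<Phi>" "\<And>Z. Z \<in> \<Z> \<Longrightarrow> independent f p r Z F" by blast
    have "independent f p r (\<Inter>\<Z>) F"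
    proof (rule independentI)
      fix I assume I: "I \<subseteq> F"
      have nonempty: "Z \<inter> pattern p r I F \<noteq> {}" if "Z \<in> \<Z>" for Z
      proof -
        from independentD[OF F(2)[OF that] I] obtain x where x: "x \<in> Z"
          "\<And>j. j \<in> I \<Longrightarrow> dist p ((f ^^ j) x) \<le> r" "\<And>j. j \<in> F - I \<Longrightarrow> 2 * r \<le> dist p ((f ^^ j) x)"
          by blast
        moreover have "x \<in> X" using x(1) good[OF that] by (auto simp: dense_subsystem_def)
        ultimately have "x \<in> Z \<inter> pattern p r I F" by (simp add: pattern_def)
        then show ?thesis by blast
      qed
      have "X \<inter> (\<Inter>Z\<in>\<Z>. Z \<inter> pattern p r I F) \<noteq> {}"
      proof (rule compact_imp_fip_image[OF compact])
        show "closed (Z \<inter> pattern p r I F)" if "Z \<in> \<Z>" for Z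
          using good[OF that] closed_pattern by (auto simp: dense_subsystem_def)
        fix \<Y> assume Y: "finite \<Y>" "\<Y> \<subseteq> \<Z>"
        obtain Z where Z: "Z \<in> \<Z>" "Z \<subseteq> \<Inter>\<Y>"
        proof (cases "\<Y> = {}")
          case True
          then show ?thesis using that ne by auto
        next
          case False
          then show ?thesis using that[of "\<Inter>\<Y>"] fin_chain[OF Y(1) _ Y(2)] by blast
        qed
        from nonempty[OF Z(1)] obtain x where "x \<in> Z" "x \<in> pattern p r I F" by blast
        then have "x \<in> X \<inter> (\<Inter>Z\<in>\<Y>. Z \<inter> pattern p r I F)"
          using Z(2) by (auto simp: pattern_def)
        then show "X \<inter> (\<Inter>Z\<in>\<Y>. Z \<inter> pattern p r I F) \<noteq> {}" by blast
      qed
      then obtain x where "x \<in> (\<Inter>Z\<in>\<Z>. Z \<inter> pattern p r I F)" by blast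
      with ne have "x \<in> \<Inter>\<Z>" "x \<in> pattern p r I F" by auto
      then show "\<exists>x\<in>\<Inter>\<Z>. (\<forall>j\<in>I. dist p ((f ^^ j) x) \<le> r) \<and> (\<forall>j\<in>F - I. 2 * r \<le> dist p ((f ^^ j) x))"
        unfolding pattern_def by blast
    qed
    with F(1) show ?thesis by (auto simp: \<Phi>_def)
  qed
  moreover have "closed (\<Inter>\<Z>)" using good by (auto simp: dense_subsystem_def)
  moreover have "\<Inter>\<Z> \<subseteq> X" using good ne unfolding dense_subsystem_def by blast
  moreover have "f ` \<Inter>\<Z> \<subseteq> \<Inter>\<Z>" using good unfolding dense_subsystem_def by blast
  ultimately show ?thesis by (simp add: dense_subsystem_def independence_density_def)
qed

lemma minimal_dense_subsystem:
  assumes "independence_density f p r \<delta> X"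
  obtains Z where "dense_subsystem p r \<delta> Z" "\<And>Y. dense_subsystem p r \<delta> Y \<Longrightarrow> Y \<subseteq> Z \<Longrightarrow> Y = Z"
proof -
  \<comment> \<open>Passing to complements turns the search for a minimal set into one for a maximal
    set, with unions as upper bounds of chains.\<close>
  define \<A> where "\<A> = {U. dense_subsystem p r \<delta> (- U)}"
  have "\<exists>M\<in>\<A>. \<forall>U\<in>\<A>. M \<subseteq> U \<longrightarrow> U = M"
  proof (rule subset_Zorn_nonempty)
    have "dense_subsystem p r \<delta> X"
      using assms invariant compact_imp_closed[OF compact] by (simp add: dense_subsystem_def)
    then have "- X \<in> \<A>" by (simp add: \<A>_def)
    then show "\<A> \<noteq> {}" by blast
    fix \<C> assume C: "\<C> \<noteq> {}" "subset.chain \<A> \<C>"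
    have "dense_subsystem p r \<delta> (\<Inter>(uminus ` \<C>))"
    proof (rule dense_subsystem_Inter)
      show "subset.chain UNIV (uminus ` \<C>)"
        using C(2) by (auto simp: subset_chain_def)
      show "dense_subsystem p r \<delta> Z" if "Z \<in> uminus ` \<C>" for Z
        using that C(2) by (auto simp: subset_chain_def \<A>_def)
    qed (use C in auto)
    moreover have "- \<Union>\<C> = \<Inter>(uminus ` \<C>)" by auto
    ultimately show "\<Union>\<C> \<in> \<A>" by (simp add: \<A>_def)
  qed
  then obtain M where M: "M \<in> \<A>" "\<And>U. U \<in> \<A> \<Longrightarrow> M \<subseteq> U \<Longrightarrow> U = M" by blast
  show thesis
  proof (rule that[of "- M"])
    show "dense_subsystem p r \<delta> (- M)" using M(1) by (simp add: \<A>_def)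
    fix Y assume "dense_subsystem p r \<delta> Y" "Y \<subseteq> - M"
    then have "- Y = M" by (intro M(2)) (auto simp: \<A>_def)
    then show "Y = - M" by blast
  qed
qed

lemma lyapunov_stable_not_independence_density:
  fixes \<delta> :: real
  assumes r: "0 < r" and \<delta>: "0 < \<delta>" and lyap: "lyapunov_stable_on f (recurrent_set f X)"
  shows "\<not> independence_density f p r \<delta> X"
proof
  assume "independence_density f p r \<delta> X"
  from minimal_dense_subsystem[OF this] obtain Z where Z: "dense_subsystem p r \<delta> Z"
    and minimal: "\<And>Y. dense_subsystem p r \<delta> Y \<Longrightarrow> Y \<subseteq> Z \<Longrightarrow> Y = Z" by blast
  have Z': "closed Z" "Z \<subseteq> X" "f ` Z \<subseteq> Z" "independence_density f p r \<delta> Z"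
    using Z by (simp_all add: dense_subsystem_def)
  have "compact Z" using compact_Int_closed[OF compact Z'(1)] Z'(2) by (simp add: Int_absorb1)
  then interpret Z: compact_dynamics f Z using Z' restrict by blast
  obtain J where J: "independent f p r Z J" "\<And>k. \<delta> * k \<le> card (J \<inter> {..<k})"
    by (rule Z.infinite_independent_set[OF \<delta> Z'(4)]) (rule that)
  obtain x where x: "x \<in> Z" "independence_density f p r \<delta> (omega_limit f x)"
    by (rule Z.independence_density_omega_limit[OF less_imp_le[OF \<delta>] J]) (rule that)
  have sub: "omega_limit f x \<subseteq> Z" using x(1) by (rule Z.omega_limit_subset)
  \<comment> \<open>The omega-limit set is itself a subsystem with the same \<open>\<delta>\<close>,
    so minimality applies.\<close>
  then have omega: "omega_limit f x = Z"
    using x Z'(2) closed_omega_limit Z.omega_limit_invariant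
    by (intro minimal) (auto simp: dense_subsystem_def)
  have rec: "x \<in> recurrent_set f X" using x(1) Z'(2) omega by (auto simp: recurrent_set_def)
  have "\<exists>k>0. \<forall>z\<in>Z. dist ((f ^^ k) z) z \<le> e" if "0 < e" for e
  proof -
    from lyap rec \<open>0 < e\<close> obtain U where U: "open U" "x \<in> U"
      "\<And>y n. y \<in> U \<Longrightarrow> y \<in> recurrent_set f X \<Longrightarrow> dist ((f ^^ n) x) ((f ^^ n) y) < e"
      unfolding lyapunov_stable_on_def by (metis IntI)
    then obtain d where d: "0 < d" "\<And>y. dist y x < d \<Longrightarrow> y \<in> U" unfolding open_dist by metis
    have "x \<in> omega_limit f x" using x(1) omega by simp
    with d(1) obtain k where k: "k \<ge> 1" "dist ((f ^^ k) x) x < d"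
      unfolding mem_omega_limit_iff by blast
    \<comment> \<open>Stability at the single point \<open>x\<close> is applied to its own return
      \<open>(f ^^ k) x\<close>.\<close>
    have shadow: "dist ((f ^^ n) x) ((f ^^ n) ((f ^^ k) x)) < e" for n
      using d(2)[OF k(2)] recurrent_set_funpow[OF rec] by (rule U(3))
    \<comment> \<open>Iterates commute, so \<open>f ^^ k\<close> moves every orbit point of
      \<open>x\<close> by less than \<open>e\<close>; orbit points converge to each \<open>z\<close>
      in the omega-limit set, and continuity carries the bound over.\<close>
    have "dist ((f ^^ k) z) z \<le> e" if "z \<in> Z" for z
    proof -
      from that omega obtain s where s: "(\<lambda>i. (f ^^ s i) x) \<longlonglongrightarrow> z"
        unfolding omega_limit_def by blast
      have lim: "(\<lambda>i. dist ((f ^^ k) ((f ^^ s i) x)) ((f ^^ s i) x)) \<longlonglongrightarrow> dist ((f ^^ k) z) z"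
        using s that Z.funpow_in[OF x(1)] by (intro tendsto_dist Z.tendsto_funpow) auto
      have "dist ((f ^^ k) ((f ^^ s i) x)) ((f ^^ s i) x) \<le> e" for i
      proof -
        have "(f ^^ k) ((f ^^ s i) x) = (f ^^ s i) ((f ^^ k) x)"
          by (metis add.commute comp_apply funpow_add)
        then show ?thesis using shadow[of "s i"] by (simp add: dist_commute)
      qed
      then show ?thesis by (intro LIMSEQ_le_const2[OF lim]) auto
    qed
    with k(1) show ?thesis by (intro exI[of _ k]) auto
  qed
  from Z.rigid_not_independence_density[OF r \<delta> this] Z'(4) show False by blast
qed

end

theorem theorem4p5:
  fixes f :: "'a::metric_space \<Rightarrow> 'a" and X :: "'a set"
  assumes "compact X" and "continuous_on X f" and "f ` X \<subseteq> X"
    and "countable {stable_class f X p | p. p \<in> X} \<or> lyapunov_stable_on f (recurrent_set f X)"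
  shows "topological_entropy f X = 0"
proof (rule ccontr)
  interpret compact_dynamics f X using assms(1-3) by unfold_locales
  assume "topological_entropy f X \<noteq> 0"
  then have "0 < topological_entropy f X" using topological_entropy_nonneg by simp
  then obtain p r \<delta> where r: "0 < r" and \<delta>: "0 < \<delta>" and dens: "independence_density f p r \<delta> X"
    by (rule positive_entropy_independence_density)
  obtain J where J: "independent f p r X J" "\<And>k. \<delta> * k \<le> card (J \<inter> {..<k})"
    by (rule infinite_independent_set[OF \<delta> dens]) (rule that)
  have "infinite J"
  proof
    assume fin: "finite J"
    obtain k :: nat where k: "card J < k * \<delta>" using reals_Archimedean3[OF \<delta>] by blast
    have "card (J \<inter> {..<k}) \<le> card J" using fin by (intro card_mono) auto
    with J(2)[of k] k show False by (simp add: mult.commute)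
  qed
  with uncountable_stable_classes[OF r J(1)] lyapunov_stable_not_independence_density[OF r \<delta>] dens assms(4)
  show False by blast
qed

end
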